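(* Let $\Lambda\subset\mathbb{D}$ be a separated Blaschke sequence. Then $\Lambda\in\mathrm{Int}\,N^+$ (hence $\Lambda\in\mathrm{Int}\,N$).
   Context: $\mathbb{D}$ is the open unit disc. $\Lambda$ is Blaschke if $\sum_{\lambda\in\Lambda}(1-|\lambda|)<\infty$, and separated if $\inf_{\lambda\neq\lambda'}\rho(\lambda,\lambda')>0$, where $\rho(z,w)=\left|\frac{z-w}{1-z\overline{w}}\right|$. The Nevanlinna class is $N=\{f\in\mathrm{Hol}(\mathbb{D}):\lim_{r\to1}\frac1{2\pi}\int_0^{2\pi}\log^+|f(re^{i\theta})|\,d\theta<\infty\}$, and the Smirnov class $N^+$ is the set of $f\in N$ with $\lim_{r\to1}\frac1{2\pi}\int_0^{2\pi}\log^+|f(re^{i\theta})|\,d\theta=\frac1{2\pi}\int_0^{2\pi}\log^+|f(e^{i\theta})|\,d\theta$ (non-tangential boundary values). For a space $X$ of holomorphic functions on $\mathbb{D}$, the trace $X|\Lambda$ is the set of sequences $(f(\lambda))_{\lambda\in\Lambda}$, $f\in X$. $\Lambda$ is free interpolating for $X$, written $\Lambda\in\mathrm{Int}\,X$, if $X|\Lambda$ is ideal, i.e. $(a_\lambda)\in X|\Lambda$ and $(\omega_\lambda)\in\ell^\infty$ imply $(\omega_\lambda a_\lambda)\in X|\Lambda$. *)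

theory Defs
  imports "HOL-Complex_Analysis.Complex_Analysis"
begin

text \<open>
  Functions on the unit disc are total functions \<open>complex \<Rightarrow> complex\<close>; their values outside
  \<open>ball 0 1\<close> play no role. A sequence of points is given by its set of values, which also serves
  as the index set of the sequences \<open>(a\<^sub>\<lambda>)\<close>; the Blaschke condition makes it countable.
\<close>

definition blaschke :: "complex set \<Rightarrow> bool" where
  "blaschke \<Lambda> \<longleftrightarrow> (\<lambda>z. 1 - cmod z) summable_on \<Lambda>"

definition pseudohyperbolic :: "complex \<Rightarrow> complex \<Rightarrow> real" where
  "pseudohyperbolic z w = cmod ((z - w) / (1 - z * cnj w))"

text \<open>The infimum is taken in \<open>ereal\<close>, so that it is \<open>\<infinity>\<close> when \<open>\<Lambda>\<close> has at most one point.\<close>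

definition separated :: "complex set \<Rightarrow> bool" where
  "separated \<Lambda> \<longleftrightarrow>
     0 < (INF (z, w) \<in> {(z, w). z \<in> \<Lambda> \<and> w \<in> \<Lambda> \<and> z \<noteq> w}. ereal (pseudohyperbolic z w))"

text \<open>Since \<open>ln 0 = 0\<close>, this has the correct value \<open>0\<close> at \<open>0\<close>.\<close>

definition log_plus :: "real \<Rightarrow> real" where
  "log_plus x = max 0 (ln x)"

definition log_mean :: "(complex \<Rightarrow> complex) \<Rightarrow> real \<Rightarrow> real" where
  "log_mean f r =
     1 / (2 * pi) * integral {0..2 * pi} (\<lambda>\<theta>. log_plus (cmod (f (of_real r * cis \<theta>))))"

definition nevanlinna_class :: "(complex \<Rightarrow> complex) set" where
  "nevanlinna_class =
     {f. f holomorphic_on ball 0 1 \<and> (\<exists>L. (log_mean f \<longlongrightarrow> L) (at_left 1))}"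

definition stolz_region :: "real \<Rightarrow> complex \<Rightarrow> complex set" where
  "stolz_region \<alpha> \<zeta> = {z \<in> ball 0 1. cmod (z - \<zeta>) < \<alpha> * (1 - cmod z)}"

definition nontangential_limit :: "(complex \<Rightarrow> complex) \<Rightarrow> complex \<Rightarrow> complex \<Rightarrow> bool" where
  "nontangential_limit f \<zeta> l \<longleftrightarrow> (\<forall>\<alpha>>1. (f \<longlongrightarrow> l) (at \<zeta> within stolz_region \<alpha> \<zeta>))"

definition boundary_function :: "(complex \<Rightarrow> complex) \<Rightarrow> (complex \<Rightarrow> complex) \<Rightarrow> bool" where
  "boundary_function f F \<longleftrightarrow>
     (AE \<theta> in lebesgue_on {0..2 * pi}. nontangential_limit f (cis \<theta>) (F (cis \<theta>)))"

text \<open>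
  A boundary function \<open>F\<close> is determined almost everywhere on the circle, so \<open>log_mean F 1\<close> does not
  depend on its choice. By the theorems of Fatou and Nevanlinna, every \<open>f \<in> nevanlinna_class\<close> has a
  boundary function, and \<open>log_plus (cmod F)\<close> is integrable; the integrability clause only prevents
  \<open>integral\<close> from being read at its default value.
\<close>

definition smirnov_class :: "(complex \<Rightarrow> complex) set" where
  "smirnov_class =
     {f \<in> nevanlinna_class. \<exists>F. boundary_function f F \<and>
        (\<lambda>\<theta>. log_plus (cmod (F (cis \<theta>)))) integrable_on {0..2 * pi} \<and>
        (log_mean f \<longlongrightarrow> log_mean F 1) (at_left 1)}"

definition trace_space :: "(complex \<Rightarrow> complex) set \<Rightarrow> complex set \<Rightarrow> (complex \<Rightarrow> complex) set" where
  "trace_space X \<Lambda> = (\<lambda>f. restrict f \<Lambda>) ` X"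

definition free_interpolating :: "(complex \<Rightarrow> complex) set \<Rightarrow> complex set \<Rightarrow> bool" where
  "free_interpolating X \<Lambda> \<longleftrightarrow>
     (\<forall>a \<in> trace_space X \<Lambda>. \<forall>\<omega>::complex \<Rightarrow> complex. bounded (\<omega> ` \<Lambda>) \<longrightarrow>
        restrict (\<lambda>z. \<omega> z * a z) \<Lambda> \<in> trace_space X \<Lambda>)"

end

theory Submission
  imports Defs
begin

text \<open>
  Put \<open>H z = (\<Sum>w. (1 - |w|\<^sup>2) * (1 + cnj w * z) / (1 - cnj w * z))\<close>, the sum over \<open>\<Lambda>\<close>. Separation
  gives \<open>- ln \<rho> \<le> C * (1 - \<rho>\<^sup>2)\<close> for the pseudohyperbolic distances that occur, and
  \<open>(1 - |z|\<^sup>2) * (1 - |w|\<^sup>2) / |1 - cnj w * z|\<^sup>2\<close> is at most the term of \<open>Re H z\<close> that belongs to \<open>w\<close>. Hence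
  the Blaschke product \<open>B\<^sub>z\<close> of the points other than \<open>z\<close> satisfies \<open>|B\<^sub>z z| \<ge> exp (- C * Re H z)\<close>.
  The weights \<open>exp (- C * H w)\<close> therefore cancel the denominators of the interpolation series
  \<open>(\<Sum>w. \<omega> w * (B\<^sub>w z / B\<^sub>w w) * ((1 - |w|\<^sup>2) / (1 - cnj w * z))\<^sup>2 * exp (- C * H w))\<close>, whose modulus is
  at most a constant times \<open>Re H z\<close>. A normal family argument over the finite subsets of \<open>\<Lambda>\<close>
  produces a bounded \<open>b\<close> with \<open>b w = \<omega> w * exp (- (C + 1) * H w)\<close> on \<open>\<Lambda>\<close>, and
  \<open>h = b * exp ((C + 1) * H)\<close> takes the values \<open>\<omega>\<close>.

  Multiplication by \<open>h\<close> preserves both classes because \<open>ln |h|\<close> is bounded by the real part of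
  \<open>G = (C + 1) * H + K\<close>, with \<open>K\<close> constant, which is quasi-bounded: Fatou's lemma bounds the integral of its
  boundary values from above by the mean over circles, the continuous partial sums of \<open>H\<close> bound
  it from below, and so dominated convergence applies to the means of \<open>h * f\<close>.
\<close>

section \<open>Differentiability of Lipschitz functions\<close>

lemma ball_midpoint_interval: "ball ((u + v) / 2) ((v - u) / 2) = {u<..<v::real}"
  by (auto simp: ball_def dist_real_def abs_if field_simps split: if_splits)

lemma interval_measure_open_interval:
  fixes g :: "real \<Rightarrow> real"
  assumes "mono g" "continuous_on UNIV g" "u < v"
  shows "emeasure (interval_measure g) {u<..<v} = ennreal (g v - g u)"
proof -
  have m: "g x \<le> g y" if "x \<le> y" for x y using assms(1) that by (simp add: monoD)
  have c: "continuous (at_right a) g" for a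
    using assms(2) continuous_on_eq_continuous_at continuous_at_imp_continuous_at_within by blast
  have ptv: "emeasure (interval_measure g) {v} = 0"
    using emeasure_interval_measure_Icc[of v v g] m assms(2) by simp
  have 1: "emeasure (interval_measure g) {u<..v} = ennreal (g v - g u)"
    using emeasure_interval_measure_Ioc[of u v g] m c assms(3) by simp
  have "{u<..v} = {u<..<v} \<union> {v}" using assms(3) by auto
  then have "emeasure (interval_measure g) {u<..v} = emeasure (interval_measure g) {u<..<v} + emeasure (interval_measure g) {v}"
    by (simp only:) (rule plus_emeasure[symmetric]; simp)
  with 1 ptv show ?thesis by simp
qed

text \<open>Used twice, in opposite directions, to sum a slope bound over a Vitali family: one of
  the two measures is Lebesgue measure, the other the Stieltjes measure of a monotone function,
  which gives an interval the increment over it.\<close>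

lemma emeasure_disjoint_UN_mono:
  assumes "countable C" "disjoint_family_on X C" "sets M = sets N"
    and "\<And>i. i \<in> C \<Longrightarrow> X i \<in> sets M"
    and "\<And>i. i \<in> C \<Longrightarrow> a * emeasure M (X i) \<le> b * emeasure N (X i)"
  shows "a * emeasure M (\<Union>i\<in>C. X i) \<le> b * emeasure N (\<Union>i\<in>C. X i)"
proof -
  have "a * emeasure M (\<Union>i\<in>C. X i) = (\<integral>\<^sup>+i. a * emeasure M (X i) \<partial>count_space C)"
    using assms by (subst emeasure_UN_countable) (auto simp: nn_integral_cmult)
  also have "\<dots> \<le> (\<integral>\<^sup>+i. b * emeasure N (X i) \<partial>count_space C)"
    by (rule nn_integral_mono) (use assms in auto)
  also have "\<dots> = b * emeasure N (\<Union>i\<in>C. X i)"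
    using assms by (subst emeasure_UN_countable) (auto simp: nn_integral_cmult)
  finally show ?thesis .
qed

text \<open>Let \<open>m\<close> be the infimum of the measures of open supersets of
  \<open>E\<close>. A nearly optimal \<open>U\<close> can be traded for \<open>T\<close>, and
  \<open>T\<close> for an open set of almost the same measure, so \<open>m \<le> k * m\<close> and
  hence \<open>m = 0\<close>.\<close>

lemma negligible_contractionI:
  fixes E :: "'a::euclidean_space set"
  assumes "bounded E" "0 \<le> k" "k < 1"
    and step: "\<And>U. open U \<Longrightarrow> U \<in> lmeasurable \<Longrightarrow> E \<subseteq> U \<Longrightarrow>
        \<exists>T. T \<in> lmeasurable \<and> E \<subseteq> T \<and> measure lebesgue T \<le> k * measure lebesgue U"
  shows "negligible E"
proof -
  define A where "A = measure lebesgue ` {U. open U \<and> U \<in> lmeasurable \<and> E \<subseteq> U}"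
  obtain r where "E \<subseteq> ball 0 r"
    using assms(1) bounded_subset_ballD by blast
  then have ne: "A \<noteq> {}" using lmeasurable_ball[of 0 r] open_ball[of 0 r] unfolding A_def by blast
  have bb: "bdd_below A" by (auto simp: A_def bdd_below_def intro!: exI[of _ 0])
  define m where "m = Inf A"
  have m0: "0 \<le> m" unfolding m_def by (rule cInf_greatest[OF ne]) (auto simp: A_def)
  have "m = 0"
  proof (rule ccontr)
    assume "m \<noteq> 0"
    with m0 have mp: "m > 0" by simp
    \<comment> \<open>This \<eta> makes \<open>k * (m + \<eta>) + \<eta> = m * (1 + k) / 2\<close>,
      which is below \<open>m\<close>.\<close>
    define \<eta> where "\<eta> = m * (1 - k) / 2 / (1 + k)"
    have \<eta>: "\<eta> > 0" using mp assms by (simp add: \<eta>_def)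
    have "Inf A < m + \<eta>" using \<eta> m_def by simp
    then obtain U where U: "open U" "U \<in> lmeasurable" "E \<subseteq> U" "measure lebesgue U < m + \<eta>"
      using cInf_less_iff[OF ne bb] by (auto simp: A_def)
    obtain T where T: "T \<in> lmeasurable" "E \<subseteq> T" "measure lebesgue T \<le> k * measure lebesgue U"
      using step[OF U(1-3)] by blast
    obtain V where V: "open V" "T \<subseteq> V" "V - T \<in> lmeasurable" "emeasure lebesgue (V - T) < ennreal \<eta>"
      using sets_lebesgue_outer_open[OF fmeasurableD[OF T(1)] \<eta>] by metis
    have VT: "V = T \<union> (V - T)" using V(2) by blast
    have Vm: "V \<in> lmeasurable" using VT fmeasurable.Un[OF T(1) V(3)] by simp
    have "measure lebesgue (V - T) < \<eta>"
      using V(4) emeasure_eq_measure2[OF V(3)] \<eta> by (simp add: ennreal_less_iff)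
    then have Vle: "measure lebesgue V < measure lebesgue T + \<eta>"
      using measure_Un_le[of T lebesgue "V - T"] T(1) V(3) VT by (simp add: fmeasurableD)
    have "m \<le> measure lebesgue V" unfolding m_def
      by (rule cInf_lower[OF _ bb], unfold A_def, rule imageI) (use V(1,2) Vm T(2) in blast)
    moreover have "measure lebesgue V < k * (m + \<eta>) + \<eta>"
      using Vle T(3) mult_left_mono[of "measure lebesgue U" "m + \<eta>" k] U(4) assms(2) by linarith
    moreover have "(1 + k) * \<eta> = m * (1 - k) / 2"
    proof -
      have "1 + k \<noteq> 0" using assms(2) by linarith
      then show ?thesis unfolding \<eta>_def by (rule nonzero_mult_div_cancel_left[of "1 + k", unfolded times_divide_eq_right[symmetric]])
    qed
    moreover have "0 < m * (1 - k)" using mult_pos_pos[OF mp, of "1 - k"] assms(3) by simp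
    ultimately show False by (simp add: algebra_simps)
  qed
  show ?thesis unfolding negligible_outer
  proof (intro allI impI)
    fix e :: real assume "e > 0"
    then have "Inf A < e" using \<open>m = 0\<close> m_def by simp
    then show "\<exists>T. E \<subseteq> T \<and> T \<in> lmeasurable \<and> measure lebesgue T < e"
      using cInf_less_iff[OF ne bb] by (auto simp: A_def)
  qed
qed

text \<open>Open intervals are balls about their midpoints, so the covering theorem for balls
  applies. The point \<open>x\<close> only has to lie inside the interval; the slope conditions that
  \<open>P\<close> will carry concern intervals that need not be centred at
  \<open>x\<close>.\<close>

lemma Vitali_covering_intervals:
  fixes S :: "real set"
  assumes "\<And>x d. x \<in> S \<Longrightarrow> 0 < d \<Longrightarrow> \<exists>u v. P u v \<and> u < x \<and> x < v \<and> v - u < d"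
  obtains C where "countable C" "\<And>u v. (u, v) \<in> C \<Longrightarrow> P u v \<and> u < v"
    "disjoint_family_on (\<lambda>(u, v). {u<..<v}) C" "negligible (S - (\<Union>(u, v)\<in>C. {u<..<v}))"
proof -
  define K where "K = {(u, v). P u v \<and> u < v}"
  have "\<exists>i. i \<in> K \<and> x \<in> ball (case i of (u, v) \<Rightarrow> (u + v) / 2) (case i of (u, v) \<Rightarrow> (v - u) / 2) \<and>
      (case i of (u, v) \<Rightarrow> (v - u) / 2) < d" if xd: "x \<in> S" "0 < d" for x d
  proof -
    obtain u v where "P u v" "u < x" "x < v" "v - u < d" using assms[OF xd] by blast
    then show ?thesis
      by (intro exI[of _ "(u, v)"]) (simp add: K_def ball_midpoint_interval)
  qed
  note cover = this
  obtain C where C: "countable C" "C \<subseteq> K"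
     "pairwise (\<lambda>i j. disjnt (ball (case i of (u, v) \<Rightarrow> (u + v) / 2) (case i of (u, v) \<Rightarrow> (v - u) / 2))
        (ball (case j of (u, v) \<Rightarrow> (u + v) / 2) (case j of (u, v) \<Rightarrow> (v - u) / 2))) C"
     "negligible (S - (\<Union>i \<in> C. ball (case i of (u, v) \<Rightarrow> (u + v) / 2) (case i of (u, v) \<Rightarrow> (v - u) / 2)))"
    by (rule Vitali_covering_theorem_balls[where K=K and S=S
      and a = "\<lambda>i. case i of (u, v) \<Rightarrow> (u + v) / 2" and r = "\<lambda>i. case i of (u, v) \<Rightarrow> (v - u) / 2", OF cover])
  have eq: "ball (case i of (u, v) \<Rightarrow> (u + v) / 2) (case i of (u, v) \<Rightarrow> (v - u) / 2) = (case i of (u, v) \<Rightarrow> {u<..<v::real})" for i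
    by (cases i) (simp add: ball_midpoint_interval)
  show ?thesis
    by (rule that[OF C(1)]) (use C(2-4) in \<open>auto simp: eq K_def disjoint_family_on_def pairwise_def disjnt_def\<close>)
qed

text \<open>
  Covering \<open>E\<close> first by intervals of slope at most \<open>p\<close> inside \<open>U\<close>, and then again by intervals of slope
  at least \<open>q\<close> inside those, shrinks the measure of \<open>U\<close> by the factor \<open>p / q < 1\<close>.
\<close>

lemma negligible_slope_oscillation:
  fixes g :: "real \<Rightarrow> real"
  assumes g: "mono g" "continuous_on UNIV g" and pq: "0 < p" "p < q" and bE: "bounded E"
    and low: "\<And>x d. x \<in> E \<Longrightarrow> 0 < d \<Longrightarrow> \<exists>u v. u < x \<and> x < v \<and> v - u < d \<and> g v - g u \<le> p * (v - u)"
    and high: "\<And>x d. x \<in> E \<Longrightarrow> 0 < d \<Longrightarrow> \<exists>u v. u < x \<and> x < v \<and> v - u < d \<and> g v - g u \<ge> q * (v - u)"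
  shows "negligible E"
proof (rule negligible_contractionI[OF bE, of "p / q"])
  let ?I = "\<lambda>(u, v). {u<..<v::real}"
  let ?\<mu> = "interval_measure g"
  have sub: "\<exists>d>0. \<forall>u v. u < x \<longrightarrow> x < v \<longrightarrow> v - u < d \<longrightarrow> {u<..<v} \<subseteq> U" if U: "open U" "x \<in> U" for U and x :: real
  proof -
    obtain d where "d > 0" "ball x d \<subseteq> U" using U openE by blast
    then show ?thesis
      by (intro exI[of _ d]) (auto simp: subset_iff dist_real_def abs_if)
  qed
  fix U :: "real set" assume U: "open U" "U \<in> lmeasurable" "E \<subseteq> U"
  have "\<exists>u v. ({u<..<v} \<subseteq> U \<and> g v - g u \<le> p * (v - u)) \<and> u < x \<and> x < v \<and> v - u < d" if x: "x \<in> E" "0 < d" for x d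
  proof -
    obtain d' where d': "d' > 0" "\<forall>u v. u < x \<longrightarrow> x < v \<longrightarrow> v - u < d' \<longrightarrow> {u<..<v} \<subseteq> U"
      using sub[OF U(1), of x] U(3) x by blast
    obtain u v where "u < x" "x < v" "v - u < min d d'" "g v - g u \<le> p * (v - u)"
      using low[OF x(1), of "min d d'"] d'(1) x(2) by auto
    with d' show ?thesis by (intro exI[of _ u] exI[of _ v]) auto
  qed
  note low' = this
  obtain C1 where C1: "countable C1" "\<And>u v. (u, v) \<in> C1 \<Longrightarrow> ({u<..<v} \<subseteq> U \<and> g v - g u \<le> p * (v - u)) \<and> u < v"
    "disjoint_family_on ?I C1" "negligible (E - (\<Union>i\<in>C1. ?I i))"
    by (rule Vitali_covering_intervals[of E "\<lambda>u v. {u<..<v} \<subseteq> U \<and> g v - g u \<le> p * (v - u)"], erule (1) low') (rule that; assumption)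
  define U1 where "U1 = (\<Union>i\<in>C1. ?I i)"
  have U1: "open U1" unfolding U1_def by (intro open_UN) auto
  have "\<exists>u v. ({u<..<v} \<subseteq> U1 \<and> g v - g u \<ge> q * (v - u)) \<and> u < x \<and> x < v \<and> v - u < d" if x: "x \<in> E \<inter> U1" "0 < d" for x d
  proof -
    obtain d' where d': "d' > 0" "\<forall>u v. u < x \<longrightarrow> x < v \<longrightarrow> v - u < d' \<longrightarrow> {u<..<v} \<subseteq> U1"
      using sub[OF U1, of x] x by blast
    obtain u v where "u < x" "x < v" "v - u < min d d'" "g v - g u \<ge> q * (v - u)"
      using high[of x "min d d'"] d'(1) x by auto
    with d' show ?thesis by (intro exI[of _ u] exI[of _ v]) auto
  qed
  note high' = this
  obtain C2 where C2: "countable C2" "\<And>u v. (u, v) \<in> C2 \<Longrightarrow> ({u<..<v} \<subseteq> U1 \<and> g v - g u \<ge> q * (v - u)) \<and> u < v"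
    "disjoint_family_on ?I C2" "negligible (E \<inter> U1 - (\<Union>i\<in>C2. ?I i))"
    by (rule Vitali_covering_intervals[of "E \<inter> U1" "\<lambda>u v. {u<..<v} \<subseteq> U1 \<and> g v - g u \<ge> q * (v - u)"], erule (1) high') (rule that; assumption)
  define U2 where "U2 = (\<Union>i\<in>C2. ?I i)"
  have U2: "open U2" unfolding U2_def by (intro open_UN) auto
  have sub1: "U1 \<subseteq> U" unfolding U1_def by (rule UN_least) (use C1(2) in \<open>auto split: prod.split\<close>)
  have sub2: "U2 \<subseteq> U1" unfolding U2_def by (rule UN_least) (use C2(2) in \<open>auto split: prod.split\<close>)
  \<comment> \<open>The Stieltjes measure of \<open>g\<close> links the two coverings: it is at most
    \<open>p\<close> times Lebesgue measure on \<open>U1\<close> and at least \<open>q\<close> times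
    Lebesgue measure on \<open>U2\<close>, while
    \<open>U2 \<subseteq> U1 \<subseteq> U\<close>.\<close>
  have mu1: "1 * emeasure ?\<mu> U1 \<le> ennreal p * emeasure lborel U1" unfolding U1_def
  proof (rule emeasure_disjoint_UN_mono[OF C1(1,3)])
    fix i assume i: "i \<in> C1"
    obtain u v where uv: "i = (u, v)" by force
    then show "1 * emeasure ?\<mu> (?I i) \<le> ennreal p * emeasure lborel (?I i)"
      using C1(2)[of u v] i pq g by (simp add: interval_measure_open_interval ennreal_mult'[symmetric] ennreal_leI)
  qed auto
  have mu2: "ennreal q * emeasure lborel U2 \<le> 1 * emeasure ?\<mu> U2" unfolding U2_def
  proof (rule emeasure_disjoint_UN_mono[OF C2(1,3)])
    fix i assume i: "i \<in> C2"
    obtain u v where uv: "i = (u, v)" by force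
    then show "ennreal q * emeasure lborel (?I i) \<le> 1 * emeasure ?\<mu> (?I i)"
      using C2(2)[of u v] i pq g by (simp add: interval_measure_open_interval ennreal_mult'[symmetric] ennreal_leI)
  qed auto
  have "ennreal q * emeasure lborel U2 \<le> emeasure ?\<mu> U1"
    using mu2 emeasure_mono[OF sub2, of ?\<mu>] U1 by simp
  also have "\<dots> \<le> ennreal p * emeasure lborel U"
    using mu1 mult_left_mono[OF emeasure_mono[OF sub1, of lborel], of "ennreal p"] U(1) by simp
  finally have le: "ennreal q * emeasure lborel U2 \<le> ennreal p * emeasure lborel U" .
  have U2m: "U2 \<in> lmeasurable"
    by (rule fmeasurableI2[OF U(2)]) (use sub1 sub2 U2 in auto)
  have "emeasure lborel U2 = ennreal (measure lebesgue U2)" "emeasure lborel U = ennreal (measure lebesgue U)"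
    using emeasure_eq_measure2[OF U2m] emeasure_eq_measure2[OF U(2)] U2 U(1) by simp_all
  with le have "q * measure lebesgue U2 \<le> p * measure lebesgue U"
    using pq by (simp flip: ennreal_mult'')
  then have U2le: "measure lebesgue U2 \<le> p / q * measure lebesgue U"
    using pq by (simp add: field_simps)
  \<comment> \<open>The points of \<open>E\<close> that one of the two Vitali families misses;
    adding them to \<open>U2\<close> covers \<open>E\<close> at no cost in measure.\<close>
  define N where "N = (E - U1) \<union> (E \<inter> U1 - U2)"
  have N: "negligible N" unfolding N_def using C1(4) C2(4) by (auto simp: U1_def U2_def)
  show "\<exists>T. T \<in> lmeasurable \<and> E \<subseteq> T \<and> measure lebesgue T \<le> p / q * measure lebesgue U"
  proof (intro exI conjI)
    show "U2 \<union> N \<in> lmeasurable" using U2m N by (auto simp: negligible_iff_measure intro: fmeasurable.Un)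
    show "E \<subseteq> U2 \<union> N" by (auto simp: N_def)
    show "measure lebesgue (U2 \<union> N) \<le> p / q * measure lebesgue U"
      using measure_Un_null_set[of U2 lebesgue N] U2m N U2le
      by (simp add: negligible_iff_null_sets fmeasurableD)
  qed
qed (use pq in auto)

text \<open>If the slopes over short intervals around \<open>x\<close> do not converge, two
  rationals \<open>p < q\<close> separate slopes that recur at arbitrarily small scale, which puts
  \<open>x\<close> into one of countably many null sets. The lower slope bound 1 keeps
  \<open>p\<close> and \<open>q\<close> positive.\<close>

lemma bilipschitz_negligible_nondifferentiable:
  fixes g :: "real \<Rightarrow> real"
  assumes lower: "\<And>x y. x < y \<Longrightarrow> y - x \<le> g y - g x"
    and upper: "\<And>x y. x < y \<Longrightarrow> g y - g x \<le> M * (y - x)"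
  shows "negligible {x. \<not> g differentiable (at x)}"
proof -
  define low where "low p x \<longleftrightarrow> (\<forall>d>0. \<exists>u v. u < x \<and> x < v \<and> v - u < d \<and> g v - g u \<le> p * (v - u))" for p x
  define high where "high q x \<longleftrightarrow> (\<forall>d>0. \<exists>u v. u < x \<and> x < v \<and> v - u < d \<and> g v - g u \<ge> q * (v - u))" for q x
  have mono: "mono g"
    by (rule monoI) (metis lower diff_ge_0_iff_ge less_eq_real_def order_trans)
  have M: "1 \<le> M" using lower[of 0 1] upper[of 0 1] by simp
  have lip: "\<bar>g x - g y\<bar> \<le> M * \<bar>x - y\<bar>" for x y
    using lower[of x y] upper[of x y] lower[of y x] upper[of y x] by (cases x y rule: linorder_cases) auto
  have cont: "continuous_on UNIV g"
  proof (rule lipschitz_on_continuous_on)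
    show "M-lipschitz_on UNIV g" using lip M by (intro lipschitz_onI) (auto simp: dist_real_def)
  qed
  \<comment> \<open>The index \<open>n\<close> cuts the exceptional sets into bounded pieces, as the
    covering argument requires.\<close>
  define N where "N = (\<Union>(p, q, n) \<in> {(p, q, n::nat). p \<in> \<rat> \<and> q \<in> \<rat> \<and> 0 < p \<and> p < q}.
      {x. low p x \<and> high q x \<and> \<bar>x\<bar> \<le> real n})"
  have "negligible N" unfolding N_def
  proof (rule negligible_countable_Union)
    have "countable (\<rat> \<times> \<rat> \<times> (UNIV :: nat set) :: (real \<times> real \<times> nat) set)"
      by (intro countable_SIGMA countable_rat) auto
    then have "countable {(p :: real, q :: real, n::nat). p \<in> \<rat> \<and> q \<in> \<rat> \<and> 0 < p \<and> p < q}"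
      by (rule countable_subset[rotated]) auto
    then show "countable ((\<lambda>(p, q, n). {x. low p x \<and> high q x \<and> \<bar>x\<bar> \<le> real n}) `
        {(p, q, n::nat). p \<in> \<rat> \<and> q \<in> \<rat> \<and> 0 < p \<and> p < q})"
      by (rule countable_image)
    fix S assume "S \<in> (\<lambda>(p, q, n). {x. low p x \<and> high q x \<and> \<bar>x\<bar> \<le> real n}) `
        {(p, q, n::nat). p \<in> \<rat> \<and> q \<in> \<rat> \<and> 0 < p \<and> p < q}"
    then obtain p q n where pq: "0 < p" "p < q" and S: "S = {x. low p x \<and> high q x \<and> \<bar>x\<bar> \<le> real n}"
      by auto
    have "bounded S" unfolding S by (rule boundedI[of _ "real n"]) auto
    then show "negligible S"
      by (rule negligible_slope_oscillation[OF mono cont pq]) (auto simp: S low_def high_def)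
  qed
  moreover have "g differentiable (at x)" if x: "x \<notin> N" for x
  proof -
    define A where "A = {p. low p x}"
    have "low M x" unfolding low_def
    proof (intro allI impI)
      fix d :: real assume "d > 0"
      then show "\<exists>u v. u < x \<and> x < v \<and> v - u < d \<and> g v - g u \<le> M * (v - u)"
        by (intro exI[of _ "x - d/3"] exI[of _ "x + d/3"] conjI upper) auto
    qed
    then have ne: "A \<noteq> {}" by (auto simp: A_def)
    have lb: "1 \<le> p" if "p \<in> A" for p
    proof -
      obtain u v where uv: "u < x" "x < v" "g v - g u \<le> p * (v - u)"
        using \<open>p \<in> A\<close> unfolding A_def low_def using zero_less_one by blast
      then have "1 * (v - u) \<le> p * (v - u)" using order_trans[OF lower[OF order.strict_trans[OF uv(1,2)]] uv(3)] by (simp only: mult_1)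
      then show ?thesis by (rule mult_right_le_imp_le) (use uv in simp)
    qed
    then have bb: "bdd_below A" by (auto simp: bdd_below_def)
    \<comment> \<open>\<open>D\<close> is the lower derivative over intervals that straddle
      \<open>x\<close>; it will turn out to be the derivative.\<close>
    define D where "D = Inf A"
    have D: "1 \<le> D" unfolding D_def by (rule cInf_greatest[OF ne lb])
    have key: "\<exists>d>0. \<forall>u v. u < x \<and> x < v \<and> v - u < d \<longrightarrow> \<bar>g v - g u - D * (v - u)\<bar> \<le> \<epsilon> * (v - u)"
      if \<epsilon>: "\<epsilon> > 0" for \<epsilon>
    proof -
      have "D - \<epsilon> \<notin> A" using cInf_lower[OF _ bb, of "D - \<epsilon>"] \<epsilon> by (auto simp: D_def)
      then obtain d1 where d1: "d1 > 0" "\<And>u v. u < x \<Longrightarrow> x < v \<Longrightarrow> v - u < d1 \<Longrightarrow> g v - g u > (D - \<epsilon>) * (v - u)"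
        unfolding A_def low_def by force
      obtain q where q: "q \<in> \<rat>" "D < q" "q < D + \<epsilon>" using Rats_dense_in_real[of D "D + \<epsilon>"] \<epsilon> by auto
      \<comment> \<open>With \<open>D < p < q < D + \<epsilon>\<close>, slopes at most
        \<open>p\<close> recur by the choice of \<open>D\<close>. As \<open>x\<close> is outside
        \<open>N\<close>, slopes of at least \<open>q\<close> cannot recur, which bounds all slopes
        over short intervals from above.\<close>
      obtain p where p: "p \<in> \<rat>" "D < p" "p < q" using Rats_dense_in_real[OF q(2)] by auto
      obtain a where a: "a \<in> A" "a < p" using p(2) cInf_less_iff[OF ne bb] by (auto simp: D_def)
      have "low p x" unfolding low_def
      proof (intro allI impI)
        fix d :: real assume "d > 0"
        then obtain u v where uv: "u < x" "x < v" "v - u < d" "g v - g u \<le> a * (v - u)"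
          using a(1) unfolding A_def low_def by blast
        moreover have "a * (v - u) \<le> p * (v - u)" using uv a(2) by (intro mult_right_mono) auto
        ultimately show "\<exists>u v. u < x \<and> x < v \<and> v - u < d \<and> g v - g u \<le> p * (v - u)"
          using order_trans by blast
      qed
      moreover obtain n :: nat where "\<bar>x\<bar> \<le> real n" using real_arch_simple by blast
      ultimately have "\<not> high q x" using x p q D unfolding N_def by auto
      then obtain d2 where d2: "d2 > 0" "\<And>u v. u < x \<Longrightarrow> x < v \<Longrightarrow> v - u < d2 \<Longrightarrow> g v - g u < q * (v - u)"
        unfolding high_def by force
      show ?thesis
      proof (intro exI[of _ "min d1 d2"] conjI allI impI)
        fix u v assume uv: "u < x \<and> x < v \<and> v - u < min d1 d2"
        have "q * (v - u) \<le> (D + \<epsilon>) * (v - u)" using uv q by (intro mult_right_mono) auto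
        then show "\<bar>g v - g u - D * (v - u)\<bar> \<le> \<epsilon> * (v - u)"
          using d1(2)[of u v] d2(2)[of u v] uv by (simp add: algebra_simps abs_if)
      qed (use d1 d2 in auto)
    qed
    \<comment> \<open>Difference quotients at \<open>x\<close> belong to intervals with
      \<open>x\<close> as an endpoint, whereas \<open>key\<close> needs \<open>x\<close> strictly
      inside. Widening the interval by \<open>t\<close> on both sides and letting \<open>t\<close>
      tend to 0 closes the gap.\<close>
    have key': "\<exists>d>0. \<forall>u v. u \<le> x \<and> x \<le> v \<and> v - u < d \<longrightarrow> \<bar>g v - g u - D * (v - u)\<bar> \<le> \<epsilon> * (v - u)"
      if \<epsilon>: "\<epsilon> > 0" for \<epsilon>
    proof -
      obtain d where d: "d > 0" "\<And>u v. u < x \<and> x < v \<and> v - u < d \<Longrightarrow> \<bar>g v - g u - D * (v - u)\<bar> \<le> \<epsilon> * (v - u)"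
        using key[OF \<epsilon>] by blast
      show ?thesis
      proof (intro exI[of _ d] conjI allI impI d(1))
        fix u v assume uv: "u \<le> x \<and> x \<le> v \<and> v - u < d"
        define k where "k t = \<bar>g (v + t) - g (u - t) - D * (v + t - (u - t))\<bar> - \<epsilon> * (v + t - (u - t))" for t
        have "continuous_on UNIV k" unfolding k_def
          by (intro continuous_intros continuous_on_compose2[OF cont]) auto
        then have "(k \<longlongrightarrow> k 0) (at_right 0)"
          by (metis UNIV_I continuous_on_def filterlim_at_split at_within_open open_UNIV)
        moreover have "\<forall>\<^sub>F t in at_right 0. k t \<le> 0"
        proof (rule eventually_at_rightI[of 0 "(d - (v - u)) / 2"])
          fix t assume "t \<in> {0<..<(d - (v - u)) / 2}"
          then show "k t \<le> 0" unfolding k_def using uv d(2)[of "u - t" "v + t"] by auto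
        qed (use uv in auto)
        ultimately have "k 0 \<le> 0" by (rule tendsto_upperbound) simp
        then show "\<bar>g v - g u - D * (v - u)\<bar> \<le> \<epsilon> * (v - u)" by (simp add: k_def)
      qed
    qed
    have "(g has_derivative (\<lambda>h. D * h)) (at x)" unfolding has_derivative_at_alt
    proof (intro conjI allI impI bounded_linear_mult_right)
      fix \<epsilon> :: real assume "\<epsilon> > 0"
      then obtain d where d: "d > 0" "\<And>u v. u \<le> x \<and> x \<le> v \<and> v - u < d \<Longrightarrow> \<bar>g v - g u - D * (v - u)\<bar> \<le> \<epsilon> * (v - u)"
        using key' by blast
      show "\<exists>d>0. \<forall>y. norm (y - x) < d \<longrightarrow> norm (g y - g x - D * (y - x)) \<le> \<epsilon> * norm (y - x)"
      proof (intro exI[of _ d] conjI allI impI d(1))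
        fix y assume y: "norm (y - x) < d"
        have sym: "\<bar>g y - g x - D * (y - x)\<bar> = \<bar>g x - g y - D * (x - y)\<bar>"
          by (simp add: abs_if algebra_simps)
        show "norm (g y - g x - D * (y - x)) \<le> \<epsilon> * norm (y - x)"
        proof (cases "x \<le> y")
          case True
          then show ?thesis using d(2)[of x y] y by simp
        next
          case False
          then show ?thesis using d(2)[of y x] y by (simp add: sym)
        qed
      qed
    qed
    then show ?thesis by (auto simp: differentiable_def)
  qed
  ultimately show ?thesis by (elim negligible_subset) blast
qed

text \<open>Adding \<open>(L + 1) * y\<close> to a coordinate moves its slopes from between
  \<open>- L\<close> and \<open>L\<close> to between 1 and \<open>2 * L + 1\<close>, so the
  bilipschitz case applies to each coordinate.\<close>

lemma lipschitz_negligible_nondifferentiable: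
  fixes f :: "real \<Rightarrow> 'a::euclidean_space"
  assumes "L-lipschitz_on UNIV f"
  shows "negligible {x. \<not> f differentiable (at x)}"
proof -
  have "negligible {x. \<not> (\<lambda>y. f y \<bullet> i) differentiable (at x)}" if i: "i \<in> Basis" for i
  proof -
    have lip: "\<bar>f x \<bullet> i - f y \<bullet> i\<bar> \<le> L * \<bar>x - y\<bar>" for x y
    proof -
      have "\<bar>(f x - f y) \<bullet> i\<bar> \<le> norm (f x - f y)" by (rule Basis_le_norm[OF i])
      also have "\<dots> \<le> L * \<bar>x - y\<bar>" using lipschitz_onD[OF assms, of x y] by (simp add: dist_norm)
      finally show ?thesis by (simp add: inner_diff_left)
    qed
    define g where "g y = f y \<bullet> i + (L + 1) * y" for y
    have "negligible {x. \<not> g differentiable (at x)}"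
    proof (rule bilipschitz_negligible_nondifferentiable[where M="2 * L + 1"])
      fix x y :: real assume "x < y"
      then show "y - x \<le> g y - g x" "g y - g x \<le> (2 * L + 1) * (y - x)"
        using lip[of x y] by (auto simp: g_def algebra_simps abs_if split: if_splits)
    qed
    moreover have "(\<lambda>y. f y \<bullet> i) differentiable (at x)" if "g differentiable (at x)" for x
    proof -
      have "(\<lambda>y. g y - (L + 1) * y) differentiable (at x)"
        by (intro differentiable_diff that differentiable_mult differentiable_const differentiable_ident)
      then show ?thesis by (simp add: g_def)
    qed
    ultimately show ?thesis by (blast intro: negligible_subset)
  qed
  then have "negligible (\<Union>i\<in>Basis. {x. \<not> (\<lambda>y. f y \<bullet> i) differentiable (at x)})"
    by (intro negligible_Union) auto
  then show ?thesis
    by (rule negligible_subset) (auto simp: differentiable_componentwise_within[of f])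
qed

section \<open>Fatou's theorem for bounded holomorphic functions\<close>

lemma unit_circle_has_integral_iff:
  "(f has_contour_integral I) (circlepath 0 1) \<longleftrightarrow>
    ((\<lambda>x. f (cis (2 * pi * x)) * (2 * pi * \<i> * cis (2 * pi * x))) has_integral I) {0..1}"
  unfolding has_contour_integral_def
  by (rule has_integral_cong)
    (simp add: vector_derivative_circlepath01, simp add: circlepath_def part_circlepath_def linepath_def cis_conv_exp algebra_simps)

lemma mean_value_unit_circle:
  assumes "continuous_on (cball 0 1) f" "f holomorphic_on ball 0 1"
  shows "((\<lambda>x. f (cis (2 * pi * x))) has_integral f 0) {0..1}"
proof -
  have "((\<lambda>u. f u / (u - 0)) has_contour_integral (2 * of_real pi * \<i> * f 0)) (circlepath 0 1)"
    by (rule Cauchy_integral_circlepath[OF assms]) simp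
  then have "((\<lambda>x. f (cis (2 * pi * x)) / cis (2 * pi * x) * (2 * pi * \<i> * cis (2 * pi * x)))
      has_integral (2 * of_real pi * \<i> * f 0)) {0..1}"
    unfolding unit_circle_has_integral_iff by simp
  then have "((\<lambda>x. (1 / (2 * pi * \<i>)) * (f (cis (2 * pi * x)) / cis (2 * pi * x) * (2 * pi * \<i> * cis (2 * pi * x))))
      has_integral (1 / (2 * pi * \<i>)) * (2 * of_real pi * \<i> * f 0)) {0..1}"
    by (rule has_integral_mult_right)
  then show ?thesis by simp
qed

lemma herglotz_kernel:
  assumes "cmod v < 1"
  shows "Re ((1 + v) / (1 - v)) = (1 - (cmod v)\<^sup>2) / (cmod (1 - v))\<^sup>2"
proof -
  have "Re ((1 + v) / (1 - v)) = Re ((1 + v) * cnj (1 - v)) / (cmod (1 - v))\<^sup>2"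
    by (simp add: complex_div_cnj[of "1 + v"] flip: Re_divide_of_real)
  also have "Re ((1 + v) * cnj (1 - v)) = 1 - (cmod v)\<^sup>2"
    unfolding cmod_power2 by (simp add: algebra_simps power2_eq_square)
  finally show ?thesis .
qed

lemma cmod_one_minus_cnj_mult:
  assumes "cmod w = 1"
  shows "cmod (1 - cnj z * w) = cmod (w - z)"
proof -
  have "1 - cnj z * w = w * cnj (w - z)"
    using assms complex_norm_square[of w] by (simp add: algebra_simps)
  then show ?thesis using assms by (simp add: norm_mult del: complex_cnj_diff)
qed

lemma one_minus_cnj_mult_nonzero:
  assumes "cmod z < 1" "cmod w \<le> 1"
  shows "1 - cnj z * w \<noteq> 0"
proof
  assume "1 - cnj z * w = 0"
  then have "cmod (cnj z * w) = 1" by (metis eq_iff_diff_eq_0 norm_one)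
  moreover have "cmod (cnj z * w) \<le> cmod z * 1"
    unfolding norm_mult complex_mod_cnj using assms by (intro mult_left_mono) auto
  ultimately show False using assms by simp
qed

text \<open>For \<open>w\<close> on the circle the Poisson kernel is the real part of
  \<open>(1 + cnj z * w) / (1 - cnj z * w)\<close>. This is holomorphic in \<open>w\<close> and
  equals 1 at 0, so the mean value property gives the integral.\<close>

lemma poisson_kernel_has_integral:
  assumes "cmod z < 1"
  shows "((\<lambda>x. (1 - (cmod z)\<^sup>2) / (cmod (cis (2 * pi * x) - z))\<^sup>2) has_integral 1) {0..1}"
proof -
  let ?f = "\<lambda>w. (1 + cnj z * w) / (1 - cnj z * w)"
  have hol: "?f holomorphic_on ball 0 1"
    by (intro holomorphic_intros) (use assms one_minus_cnj_mult_nonzero in auto)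
  have "continuous_on (cball 0 1) ?f"
    by (intro continuous_intros ballI) (use assms one_minus_cnj_mult_nonzero in auto)
  from has_integral_Re[OF mean_value_unit_circle[OF this hol]]
  have "((\<lambda>x. Re (?f (cis (2 * pi * x)))) has_integral 1) {0..1}" by simp
  moreover have "Re (?f (cis (2 * pi * x))) = (1 - (cmod z)\<^sup>2) / (cmod (cis (2 * pi * x) - z))\<^sup>2" for x
    using herglotz_kernel[of "cnj z * cis (2 * pi * x)"] assms
    by (simp add: norm_mult cmod_one_minus_cnj_mult)
  ultimately show ?thesis by simp
qed

text \<open>
  The subtracted term is the Cauchy kernel of the reflected point \<open>1 / cnj z\<close>, which integrates to \<open>0\<close>
  against holomorphic functions. It improves the decay of \<open>1 / (w - z)\<^sup>2\<close> by one order, without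
  which the estimate in the nontangential limit would diverge logarithmically.
\<close>

lemma reflected_kernel_bound:
  assumes w: "cmod w = 1" and z: "cmod z < 1"
  shows "cmod (1 / (w - z)\<^sup>2 - (cnj z)\<^sup>2 / (1 - cnj z * w)\<^sup>2) \<le> 4 * (1 - cmod z) / (cmod (w - z)) ^ 3"
proof -
  define d where "d = w - z"
  have d0: "d \<noteq> 0" using w z by (auto simp: d_def)
  have w1: "w * cnj w = 1" using complex_norm_square[of w] w by simp
  have w0: "w \<noteq> 0" using w by auto
  have e: "1 - cnj z * w = w * cnj d" using w1 by (simp add: d_def algebra_simps)
  \<comment> \<open>The difference of the two kernels factors as a difference of squares, and this
    factor has modulus \<open>1 - |z|\<^sup>2\<close>; the additional order of decay comes from
    here.\<close>
  have f1: "cnj d + cnj z * cnj w * d = cnj w * (1 - of_real ((cmod z)\<^sup>2))"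
    unfolding d_def complex_norm_square complex_cnj_diff using w1 by algebra
  have inv: "1 / w = cnj w" using w1 w0 by (simp add: field_simps)
  have "1 / d\<^sup>2 - (cnj z)\<^sup>2 / (w * cnj d)\<^sup>2 = 1 / d\<^sup>2 - (cnj z * cnj w)\<^sup>2 / (cnj d)\<^sup>2"
    by (simp add: power_mult_distrib flip: inv) (simp add: field_simps)
  also have "\<dots> = (cnj d - cnj z * cnj w * d) * (cnj d + cnj z * cnj w * d) / (d * cnj d)\<^sup>2"
    using d0 by (simp add: field_simps power2_eq_square)
  finally have "cmod (1 / d\<^sup>2 - (cnj z)\<^sup>2 / (w * cnj d)\<^sup>2)
      = cmod (cnj d - cnj z * cnj w * d) * cmod (cnj d + cnj z * cnj w * d) / (cmod d)^4"
    by (simp add: norm_mult norm_divide norm_power power2_eq_square power4_eq_xxxx)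
  also have "\<dots> \<le> (2 * cmod d) * (2 * (1 - cmod z)) / (cmod d)^4"
  proof (intro divide_right_mono mult_mono)
    have "cmod (cnj d - cnj z * cnj w * d) \<le> cmod (cnj d) + cmod (cnj z * cnj w * d)" by (rule norm_triangle_ineq4)
    also have "\<dots> \<le> cmod d + 1 * cmod d" using z w by (simp add: norm_mult mult_left_le_one_le)
    finally show "cmod (cnj d - cnj z * cnj w * d) \<le> 2 * cmod d" by simp
    have "cmod (cnj d + cnj z * cnj w * d) = cmod (1 - of_real ((cmod z)\<^sup>2))"
      unfolding f1 using w by (simp add: norm_mult)
    also have "\<dots> = 1 - (cmod z)\<^sup>2"
      using z abs_square_le_1[of "cmod z"] by (metis abs_of_nonneg diff_ge_0_iff_ge less_imp_le norm_of_real of_real_1 of_real_diff abs_norm_cancel)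
    also have "\<dots> = (1 + cmod z) * (1 - cmod z)" by (simp add: algebra_simps power2_eq_square)
    also have "\<dots> \<le> 2 * (1 - cmod z)" using z by (intro mult_right_mono) auto
    finally show "cmod (cnj d + cnj z * cnj w * d) \<le> 2 * (1 - cmod z)" .
  qed auto
  also have "\<dots> = 4 * (1 - cmod z) / (cmod d)^3"
    using d0 by (simp add: field_simps power_numeral_reduce)
  finally show ?thesis unfolding e d_def .
qed

text \<open>The reflected kernel is subtracted from Cauchy's formula for the derivative without
  changing its value. The bound is phrased with the Poisson kernel and a constant because the means
  of both over the circle are known exactly.\<close>

lemma deriv_bound_reflected_kernel:
  assumes cont: "continuous_on (cball 0 1) \<phi>" and hol: "\<phi> holomorphic_on ball 0 1" and z: "cmod z < 1"
    and a: "0 \<le> a" and b: "0 \<le> b"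
    and bound: "\<And>w. cmod w = 1 \<Longrightarrow> cmod (\<phi> w) * (4 * (1 - cmod z) / (cmod (w - z)) ^ 3)
        \<le> a * ((1 - (cmod z)\<^sup>2) / (cmod (w - z))\<^sup>2) + b"
  shows "cmod (deriv \<phi> z) \<le> a + b"
proof -
  let ?K = "\<lambda>w. 1 / (w - z)\<^sup>2 - (cnj z)\<^sup>2 / (1 - cnj z * w)\<^sup>2"
  have 1: "((\<lambda>u. \<phi> u / (u - z)\<^sup>2) has_contour_integral (2 * pi * \<i> * deriv \<phi> z)) (circlepath 0 1)"
    using Cauchy_has_contour_integral_higher_derivative_circlepath[OF cont hol, of z 1] z
    by (simp add: numeral_2_eq_2)
  have 2: "((\<lambda>u. \<phi> u * ((cnj z)\<^sup>2 / (1 - cnj z * u)\<^sup>2)) has_contour_integral 0) (circlepath 0 1)"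
  proof (rule Cauchy_theorem_disc[where K = "{}" and a = 0 and e = 1])
    show "continuous_on (cball 0 1) (\<lambda>u. \<phi> u * ((cnj z)\<^sup>2 / (1 - cnj z * u)\<^sup>2))"
      by (intro continuous_intros cont ballI) (use z one_minus_cnj_mult_nonzero in auto)
    show "(\<lambda>u. \<phi> u * ((cnj z)\<^sup>2 / (1 - cnj z * u)\<^sup>2)) field_differentiable at x" if "x \<in> ball 0 1 - {}" for x
    proof -
      have "(\<lambda>u. \<phi> u * ((cnj z)\<^sup>2 / (1 - cnj z * u)\<^sup>2)) holomorphic_on ball 0 1"
        by (intro holomorphic_intros hol) (use z one_minus_cnj_mult_nonzero in auto)
      then show ?thesis using that by (simp add: holomorphic_on_open field_differentiable_def)
    qed
  qed (auto simp: path_image_circlepath)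
  have "((\<lambda>u. \<phi> u * ?K u) has_contour_integral (2 * pi * \<i> * deriv \<phi> z)) (circlepath 0 1)"
    using has_contour_integral_diff[OF 1 2] by (simp add: algebra_simps)
  then have int: "((\<lambda>x. \<phi> (cis (2 * pi * x)) * ?K (cis (2 * pi * x)) * (2 * pi * \<i> * cis (2 * pi * x)))
      has_integral (2 * pi * \<i> * deriv \<phi> z)) {0..1}"
    unfolding unit_circle_has_integral_iff by simp
  have P: "((\<lambda>x. 2 * pi * (a * ((1 - (cmod z)\<^sup>2) / (cmod (cis (2 * pi * x) - z))\<^sup>2) + b))
      has_integral 2 * pi * (a * 1 + (b * (1 - 0)))) {0..1}"
    using has_integral_const_real[of b 0 1]
    by (intro has_integral_mult_right has_integral_add poisson_kernel_has_integral z) (simp add: mult.commute)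
  have "cmod (2 * pi * \<i> * deriv \<phi> z) \<le> 2 * pi * (a + b)"
  proof -
    have "cmod (integral {0..1} (\<lambda>x. \<phi> (cis (2 * pi * x)) * ?K (cis (2 * pi * x)) * (2 * pi * \<i> * cis (2 * pi * x))))
       \<le> integral {0..1} (\<lambda>x. 2 * pi * (a * ((1 - (cmod z)\<^sup>2) / (cmod (cis (2 * pi * x) - z))\<^sup>2) + b))"
    proof (rule integral_norm_bound_integral)
      fix x :: real assume "x \<in> {0..1}"
      let ?w = "cis (2 * pi * x)"
      have "cmod (\<phi> ?w * ?K ?w) \<le> cmod (\<phi> ?w) * (4 * (1 - cmod z) / (cmod (?w - z)) ^ 3)"
        unfolding norm_mult by (intro mult_left_mono reflected_kernel_bound z) auto
      also have "\<dots> \<le> a * ((1 - (cmod z)\<^sup>2) / (cmod (?w - z))\<^sup>2) + b" by (rule bound) simp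
      finally show "cmod (\<phi> ?w * ?K ?w * (2 * pi * \<i> * ?w)) \<le> 2 * pi * (a * ((1 - (cmod z)\<^sup>2) / (cmod (?w - z))\<^sup>2) + b)"
        by (simp add: norm_mult[of "\<phi> ?w * ?K ?w"]) (simp add: norm_mult mult.commute mult_left_mono)
    qed (use int P in blast)+
    then show ?thesis using integral_unique[OF int] integral_unique[OF P] by simp
  qed
  then show ?thesis by (simp add: norm_mult)
qed

text \<open>Turns smallness in the angle into smallness in the chord. Near 1 the derivative of
  \<open>Ln\<close> gives \<open>|Arg u| \<le> 2 * |u - 1|\<close>; the factor 2 explains
  \<open>\<epsilon> / 2\<close> and \<open>d / 2\<close>.\<close>

lemma differentiable_cis_sphere_little_o:
  assumes "((\<lambda>\<theta>. \<phi> (cis \<theta>)) has_vector_derivative 0) (at \<theta>0)" "\<phi> (cis \<theta>0) = 0" and \<epsilon>: "0 < \<epsilon>"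
  obtains \<eta> where "0 < \<eta>" "\<And>w. cmod w = 1 \<Longrightarrow> cmod (w - cis \<theta>0) < \<eta> \<Longrightarrow> cmod (\<phi> w) \<le> \<epsilon> * cmod (w - cis \<theta>0)"
proof -
  obtain d where d: "d > 0" "\<And>y. \<bar>y - \<theta>0\<bar> < d \<Longrightarrow> cmod (\<phi> (cis y)) \<le> \<epsilon> / 2 * \<bar>y - \<theta>0\<bar>"
  proof -
    have "\<forall>e>0. \<exists>d>0. \<forall>y. norm (y - \<theta>0) < d \<longrightarrow> cmod (\<phi> (cis y)) \<le> e * norm (y - \<theta>0)"
      using assms(1,2) unfolding has_vector_derivative_def has_derivative_at_alt by simp
    then have "\<exists>d>0. \<forall>y. norm (y - \<theta>0) < d \<longrightarrow> cmod (\<phi> (cis y)) \<le> \<epsilon> / 2 * norm (y - \<theta>0)"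
      using \<epsilon> half_gt_zero by blast
    then show ?thesis using that by (auto simp only: real_norm_def)
  qed
  have "(Ln has_derivative (\<lambda>h. h)) (at (1::complex))"
    by (rule has_derivative_eq_rhs[OF has_field_derivative_Ln[of 1, unfolded has_field_derivative_def]]) auto
  then obtain e where e: "e > 0" "\<And>u. cmod (u - 1) < e \<Longrightarrow> cmod (Ln u - (u - 1)) \<le> cmod (u - 1)"
    unfolding has_derivative_at_alt by (metis Ln_1 diff_zero mult_1 zero_less_one)
  show ?thesis
  proof (rule that[of "min (d / 2) e"])
    fix w assume w: "cmod w = 1" "cmod (w - cis \<theta>0) < min (d / 2) e"
    define u where "u = w * cis (- \<theta>0)"
    have wu: "w = cis \<theta>0 * u" by (simp add: u_def mult.commute mult.left_commute cis_mult)
    have "u - 1 = (w - cis \<theta>0) * cis (- \<theta>0)" by (simp add: u_def algebra_simps cis_mult)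
    then have u1: "cmod (u - 1) = cmod (w - cis \<theta>0)" by (simp add: norm_mult)
    have nu: "cmod u = 1" using w by (simp add: u_def norm_mult)
    then have u0: "u \<noteq> 0" by auto
    have "u = cis (Arg u)" using cis_Arg[OF u0] nu by (simp add: sgn_eq)
    then have wc: "w = cis (\<theta>0 + Arg u)" using wu by (metis cis_mult)
    have "\<bar>Arg u\<bar> \<le> cmod (Ln u)" using abs_Im_le_cmod[of "Ln u"] u0 by (simp add: Arg_eq_Im_Ln)
    also have "\<dots> \<le> cmod (Ln u - (u - 1)) + cmod (u - 1)" using norm_triangle_sub[of "Ln u" "u - 1"] by simp
    also have "\<dots> \<le> 2 * cmod (u - 1)" using e(2)[of u] w u1 by simp
    finally have a: "\<bar>Arg u\<bar> \<le> 2 * cmod (w - cis \<theta>0)" by (simp add: u1)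
    then have "cmod (\<phi> w) \<le> \<epsilon> / 2 * \<bar>Arg u\<bar>" using d(2)[of "\<theta>0 + Arg u"] w wc by simp
    also have "\<dots> \<le> \<epsilon> / 2 * (2 * cmod (w - cis \<theta>0))" using a \<epsilon> by (intro mult_left_mono) auto
    finally show "cmod (\<phi> w) \<le> \<epsilon> * cmod (w - cis \<theta>0)" by simp
  qed (use d e in auto)
qed

text \<open>Subtracting the first-order expansion at \<zeta> leaves \<phi> with
  \<open>\<phi> w = o(|w - \<zeta>|)\<close> on the circle, and the derivative of \<phi> has to tend
  to 0. In the kernel bound, points \<open>w\<close> near \<zeta> contribute a small multiple of the
  Poisson kernel, the others a multiple of \<open>1 - |z|\<close>.\<close>

lemma nontangential_limit_deriv:
  assumes cont: "continuous_on (cball 0 1) F" and hol: "F holomorphic_on ball 0 1"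
    and diff: "(\<lambda>\<theta>. F (cis \<theta>)) differentiable (at \<theta>0)"
  shows "\<exists>l. nontangential_limit (deriv F) (cis \<theta>0) l"
proof -
  define \<zeta> where "\<zeta> = cis \<theta>0"
  have \<zeta>: "cmod \<zeta> = 1" by (simp add: \<zeta>_def)
  obtain D where D: "((\<lambda>\<theta>. F (cis \<theta>)) has_vector_derivative D) (at \<theta>0)"
    using diff vector_derivative_works by blast
  \<comment> \<open>Along the circle \<open>w = cis \<theta>\<close> has derivative
    \<open>\<i> * w\<close>, so \<open>A\<close> is the complex derivative that matches the
    tangential one.\<close>
  define A where "A = D / (\<i> * \<zeta>)"
  define \<phi> where "\<phi> w = F w - F \<zeta> - A * (w - \<zeta>)" for w
  have AD: "A * (\<i> * \<zeta>) = D" using \<zeta> by (auto simp: A_def)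
  have "((\<lambda>\<theta>. \<phi> (cis \<theta>)) has_vector_derivative (D - 0 - A * (\<i> * \<zeta> - 0))) (at \<theta>0)"
    unfolding \<phi>_def \<zeta>_def
    by (intro has_vector_derivative_diff D has_vector_derivative_const has_vector_derivative_mult_right)
      (auto simp: cis_conv_exp intro!: has_vector_derivative_real_field derivative_eq_intros)
  then have small: "((\<lambda>\<theta>. \<phi> (cis \<theta>)) has_vector_derivative 0) (at \<theta>0)" "\<phi> (cis \<theta>0) = 0"
    using AD by (simp_all add: \<phi>_def \<zeta>_def)
  have contp: "continuous_on (cball 0 1) \<phi>" unfolding \<phi>_def by (intro continuous_intros cont)
  have holp: "\<phi> holomorphic_on ball 0 1" unfolding \<phi>_def by (intro holomorphic_intros hol)
  have derp: "deriv \<phi> z = deriv F z - A" if "cmod z < 1" for z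
  proof -
    have "F field_differentiable at z"
      using hol that by (simp add: holomorphic_on_open field_differentiable_def)
    then have "(\<phi> has_field_derivative (deriv F z - 0 - A * (1 - 0))) (at z)"
      unfolding \<phi>_def by (intro DERIV_diff DERIV_cmult DERIV_const DERIV_ident) (simp add: field_differentiable_derivI)
    then show ?thesis by (simp add: DERIV_imp_deriv)
  qed
  have "compact (\<phi> ` sphere 0 1)"
    by (intro compact_continuous_image continuous_on_subset[OF contp]) auto
  then obtain K where K: "K > 0" "\<And>w. cmod w = 1 \<Longrightarrow> cmod (\<phi> w) \<le> K"
    using compact_imp_bounded[of "\<phi> ` sphere 0 1"] by (auto simp: bounded_pos)
  have "nontangential_limit (deriv F) \<zeta> A" unfolding nontangential_limit_def
  proof (intro allI impI tendstoI)
    fix \<alpha> e :: real assume \<alpha>: "1 < \<alpha>" and e: "0 < e"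
    \<comment> \<open>Near \<zeta> the estimate yields
      \<open>4 * \<epsilon> * (1 + \<alpha>) = e / 4\<close>. Away from \<zeta> the constant
      \<open>C\<close> below bounds \<phi> times the kernel, and
      \<open>|z - \<zeta>| < e / (2 * C)\<close> keeps that part below \<open>e / 2\<close>.\<close>
    define \<epsilon> where "\<epsilon> = e / (16 * (1 + \<alpha>))"
    have \<epsilon>: "\<epsilon> > 0" using \<alpha> e by (simp add: \<epsilon>_def)
    obtain \<eta> where \<eta>: "0 < \<eta>" "\<And>w. cmod w = 1 \<Longrightarrow> cmod (w - \<zeta>) < \<eta> \<Longrightarrow> cmod (\<phi> w) \<le> \<epsilon> * cmod (w - \<zeta>)"
      using differentiable_cis_sphere_little_o[OF small \<epsilon>] unfolding \<zeta>_def by blast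
    define C where "C = 4 * K * ((1 + \<alpha>) / \<eta>) ^ 3"
    have C: "C > 0" using K \<eta> \<alpha> by (simp add: C_def)
    have main: "dist (deriv F z) A < e" if z: "z \<in> stolz_region \<alpha> \<zeta>" "dist z \<zeta> < e / (2 * C)" for z
    proof -
      have z1: "cmod z < 1" and zs: "cmod (z - \<zeta>) < \<alpha> * (1 - cmod z)" using z by (auto simp: stolz_region_def)
      have \<delta>: "1 - cmod z \<le> cmod (z - \<zeta>)" using norm_triangle_ineq2[of \<zeta> z] \<zeta> by (simp add: norm_minus_commute)
      have "cmod (deriv \<phi> z) \<le> 4 * \<epsilon> * (1 + \<alpha>) + C * (1 - cmod z)"
      proof (rule deriv_bound_reflected_kernel[OF contp holp z1])
        fix w :: complex assume w: "cmod w = 1"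
        define d where "d = cmod (w - z)"
        have d\<delta>: "1 - cmod z \<le> d" unfolding d_def using norm_triangle_ineq2[of w z] w by simp
        then have d0: "d > 0" using z1 by simp
        \<comment> \<open>Nontangential approach enters here: in the Stolz region \<open>|z -
          \<zeta>| < \<alpha> * (1 - |z|) \<le> \<alpha> * |w - z|\<close>, so
          \<open>|w - \<zeta>|\<close> is controlled by \<open>|w - z|\<close>.\<close>
        have "cmod (w - \<zeta>) \<le> d + cmod (z - \<zeta>)" unfolding d_def using norm_triangle_ineq[of "w - z" "z - \<zeta>"] by simp
        also have "\<dots> \<le> d + \<alpha> * d" using zs mult_left_mono[OF d\<delta>, of \<alpha>] \<alpha> by linarith
        finally have wd: "cmod (w - \<zeta>) \<le> (1 + \<alpha>) * d" by (simp add: algebra_simps)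
        have sq: "1 - cmod z \<le> 1 - (cmod z)\<^sup>2" using z1 by (simp add: power2_eq_square mult_left_le_one_le)
        have nn: "0 \<le> 4 * \<epsilon> * (1 + \<alpha>) * ((1 - (cmod z)\<^sup>2) / d\<^sup>2)"
          using \<epsilon> \<alpha> sq z1 by (intro mult_nonneg_nonneg divide_nonneg_nonneg) auto
        show "cmod (\<phi> w) * (4 * (1 - cmod z) / (cmod (w - z)) ^ 3)
          \<le> 4 * \<epsilon> * (1 + \<alpha>) * ((1 - (cmod z)\<^sup>2) / (cmod (w - z))\<^sup>2) + C * (1 - cmod z)"
        proof (cases "cmod (w - \<zeta>) < \<eta>")
          case True
          have "cmod (\<phi> w) \<le> \<epsilon> * ((1 + \<alpha>) * d)"
            using \<eta>(2)[OF w True] mult_left_mono[OF wd, of \<epsilon>] \<epsilon> by linarith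
          then have "cmod (\<phi> w) * (4 * (1 - cmod z) / d ^ 3) \<le> \<epsilon> * ((1 + \<alpha>) * d) * (4 * (1 - cmod z) / d ^ 3)"
            using z1 d0 by (intro mult_right_mono) auto
          also have "\<dots> = 4 * \<epsilon> * (1 + \<alpha>) * ((1 - cmod z) / d\<^sup>2)"
            using d0 by (simp add: field_simps power2_eq_square power3_eq_cube)
          also have "\<dots> \<le> 4 * \<epsilon> * (1 + \<alpha>) * ((1 - (cmod z)\<^sup>2) / d\<^sup>2)"
            using \<epsilon> \<alpha> sq by (intro mult_left_mono divide_right_mono) auto
          also have "\<dots> \<le> \<dots> + C * (1 - cmod z)" using C z1 by simp
          finally show ?thesis by (simp add: d_def)
        next
          case False
          then have "\<eta> \<le> (1 + \<alpha>) * d" using wd by simp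
          then have "1 / d \<le> (1 + \<alpha>) / \<eta>" using d0 \<eta>(1) by (simp add: field_simps)
          then have "(1 / d) ^ 3 \<le> ((1 + \<alpha>) / \<eta>) ^ 3" using d0 by (intro power_mono) auto
          then have "cmod (\<phi> w) * (4 * (1 - cmod z) * (1 / d) ^ 3) \<le> K * (4 * (1 - cmod z) * ((1 + \<alpha>) / \<eta>) ^ 3)"
            using K w z1 d0 by (intro mult_mono) auto
          also have "\<dots> = C * (1 - cmod z)" by (simp add: C_def)
          finally show ?thesis using nn by (simp add: d_def power_one_over)
        qed
      qed (use \<epsilon> \<alpha> C z1 in auto)
      moreover have "4 * \<epsilon> * (1 + \<alpha>) = e / 4" using \<alpha> by (simp add: \<epsilon>_def field_simps)
      moreover have "C * (1 - cmod z) < e / 2"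
      proof -
        have "1 - cmod z < e / (2 * C)" using \<delta> z(2) by (simp add: dist_norm)
        then show ?thesis using C by (simp add: field_simps)
      qed
      ultimately show ?thesis using derp[OF z1] e by (simp add: dist_norm)
    qed
    have "e / (2 * C) > 0" using e C by simp
    then show "\<forall>\<^sub>F x in at \<zeta> within stolz_region \<alpha> \<zeta>. dist (deriv F x) A < e"
      unfolding eventually_at using main by blast
  qed
  then show ?thesis unfolding \<zeta>_def by blast
qed

lemma dist_cis_le: "dist (cis a) (cis b) \<le> \<bar>a - b\<bar>"
proof -
  have "cis a - cis b = cis b * (cis (a - b) - 1)" by (simp add: algebra_simps cis_mult)
  then have "dist (cis a) (cis b) = cmod (exp (\<i> * of_real (a - b)) - 1)"
    by (simp only: dist_norm norm_mult norm_cis mult_1) (simp add: cis_conv_exp)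
  also have "\<dots> = 2 * \<bar>sin ((a - b) / 2)\<bar>" by (rule dist_exp_i_1)
  also have "\<dots> \<le> \<bar>a - b\<bar>" using abs_sin_x_le_abs_x[of "(a - b) / 2"] by simp
  finally show ?thesis .
qed

lemma nontangential_limit_cong:
  assumes "\<And>z. z \<in> ball 0 1 \<Longrightarrow> f z = g z"
  shows "nontangential_limit f \<zeta> l \<longleftrightarrow> nontangential_limit g \<zeta> l"
proof -
  have "(f \<longlongrightarrow> l) (at \<zeta> within stolz_region \<alpha> \<zeta>) \<longleftrightarrow> (g \<longlongrightarrow> l) (at \<zeta> within stolz_region \<alpha> \<zeta>)" for \<alpha>
    by (rule filterlim_cong) (auto simp: eventually_at_filter stolz_region_def intro!: assms always_eventually)
  then show ?thesis by (simp add: nontangential_limit_def)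
qed

text \<open>
  A primitive of \<open>f\<close> is Lipschitz on the closed disc, and \<open>f\<close> has a nontangential limit wherever
  the primitive is differentiable along the circle.
\<close>

theorem Fatou_bounded_holomorphic:
  assumes hol: "f holomorphic_on ball 0 1" and bound: "\<And>z. z \<in> ball 0 1 \<Longrightarrow> cmod (f z) \<le> M"
  shows "negligible {\<theta>. \<nexists>l. nontangential_limit f (cis \<theta>) l}"
proof -
  obtain F where F: "\<And>z. z \<in> ball 0 1 \<Longrightarrow> (F has_field_derivative f z) (at z within ball 0 1)"
    using holomorphic_convex_primitive'[OF convex_ball open_ball hol] by blast
  have M0: "0 \<le> M" using bound[of 0] norm_ge_zero[of "f 0"] by (simp del: norm_ge_zero)
  have lip: "M-lipschitz_on (ball 0 1) F"
  proof (rule lipschitz_onI)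
    fix x y :: complex assume "x \<in> ball 0 1" "y \<in> ball 0 1"
    then show "dist (F x) (F y) \<le> M * dist x y"
      using field_differentiable_bound[OF convex_ball F bound] by (simp add: dist_norm)
  qed (rule M0)
  then obtain G where G: "M-lipschitz_on (cball 0 1) G" "\<And>x. x \<in> ball 0 1 \<Longrightarrow> G x = F x"
    using lipschitz_extend_closure[OF lip] unfolding closure_ball[OF zero_less_one] by blast
  have der: "(G has_field_derivative f z) (at z)" if "z \<in> ball 0 1" for z
  proof -
    have "(F has_field_derivative f z) (at z)" using F[OF that] by (simp only: at_within_open[OF that open_ball])
    then show ?thesis
      by (rule has_field_derivative_transform_within_open[OF _ open_ball that]) (simp add: G(2))
  qed
  have "M-lipschitz_on UNIV (\<lambda>\<theta>. G (cis \<theta>))"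
  proof (rule lipschitz_onI)
    fix a b :: real
    have "dist (G (cis a)) (G (cis b)) \<le> M * dist (cis a) (cis b)"
      by (rule lipschitz_onD[OF G(1)]) auto
    also have "\<dots> \<le> M * dist a b" using dist_cis_le[of a b] M0 by (intro mult_left_mono) (auto simp: dist_real_def)
    finally show "dist (G (cis a)) (G (cis b)) \<le> M * dist a b" .
  qed (rule M0)
  then have "negligible {\<theta>. \<not> (\<lambda>\<theta>. G (cis \<theta>)) differentiable (at \<theta>)}"
    by (rule lipschitz_negligible_nondifferentiable)
  moreover have "\<exists>l. nontangential_limit f (cis \<theta>) l" if "(\<lambda>\<theta>. G (cis \<theta>)) differentiable (at \<theta>)" for \<theta>
  proof -
    have "G holomorphic_on ball 0 1" using der holomorphic_on_open[OF open_ball] by blast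
    then have "\<exists>l. nontangential_limit (deriv G) (cis \<theta>) l"
      using lipschitz_on_continuous_on[OF G(1)] that by (intro nontangential_limit_deriv) auto
    moreover have "deriv G z = f z" if "z \<in> ball 0 1" for z
      using der[OF that] by (rule DERIV_imp_deriv)
    ultimately show ?thesis using nontangential_limit_cong[of "deriv G" f] by metis
  qed
  ultimately show ?thesis by (blast intro: negligible_subset)
qed

section \<open>Means of the positive part of the logarithm\<close>

text \<open>This form keeps the argument of \<open>ln\<close> at 1 or above, which makes continuity
  at 0 and comparison with \<open>exp\<close> immediate.\<close>

lemma log_plus_eq_ln_max: "0 \<le> x \<Longrightarrow> log_plus x = ln (max 1 x)"
  by (cases "x = 0") (auto simp: log_plus_def max_def)

lemma log_plus_nonneg: "0 \<le> log_plus x"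
  by (simp add: log_plus_def)

lemma le_exp_log_plus: "0 \<le> x \<Longrightarrow> x \<le> exp (log_plus x)"
  by (simp add: log_plus_eq_ln_max)

lemma log_plus_le_iff:
  assumes "0 \<le> x" "0 \<le> t"
  shows "log_plus x \<le> t \<longleftrightarrow> x \<le> exp t"
proof -
  have "ln (max 1 x) \<le> ln (exp t) \<longleftrightarrow> max 1 x \<le> exp t" by (rule ln_le_cancel_iff) auto
  then show ?thesis using assms by (simp add: log_plus_eq_ln_max)
qed

lemma log_plus_mult_le:
  assumes "0 \<le> x" "0 \<le> y" "x \<le> exp t" "0 \<le> t"
  shows "log_plus (x * y) \<le> t + log_plus y"
proof -
  have "x * y \<le> exp t * exp (log_plus y)"
    using assms le_exp_log_plus by (intro mult_mono) auto
  then show ?thesis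
    using assms log_plus_nonneg[of y] by (subst log_plus_le_iff) (auto simp: exp_add)
qed

lemma continuous_on_log_plus: "continuous_on {0..} log_plus"
proof -
  have "continuous_on {0..} (\<lambda>x::real. ln (max 1 x))"
    by (intro continuous_on_ln continuous_on_max continuous_on_const continuous_on_id ballI) auto
  then show ?thesis by (rule continuous_on_eq) (simp add: log_plus_eq_ln_max)
qed

lemma continuous_on_log_plus_norm [continuous_intros]:
  fixes f :: "'a::topological_space \<Rightarrow> complex"
  assumes "continuous_on S f"
  shows "continuous_on S (\<lambda>x. log_plus (cmod (f x)))"
  by (rule continuous_on_compose2[OF continuous_on_log_plus]) (auto intro!: continuous_intros assms)

lemma tendsto_log_plus_norm:
  fixes f :: "'a \<Rightarrow> complex"
  assumes "(f \<longlongrightarrow> l) F"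
  shows "((\<lambda>x. log_plus (cmod (f x))) \<longlongrightarrow> log_plus (cmod l)) F"
  by (rule continuous_on_tendsto_compose[OF continuous_on_log_plus tendsto_norm[OF assms]]) auto

lemma mean_value_circle:
  fixes f :: "complex \<Rightarrow> complex"
  assumes "continuous_on (cball 0 1) f" "f holomorphic_on ball 0 1"
  shows "((\<lambda>\<theta>. f (cis \<theta>)) has_integral 2 * pi * f 0) {0..2 * pi}"
proof -
  have "((\<lambda>x. f (cis (2 * pi * ((1 / (2 * pi)) *\<^sub>R x + 0)))) has_integral (1 / (\<bar>1 / (2 * pi)\<bar> ^ DIM(real))) *\<^sub>R f 0)
    ((\<lambda>x. (1 / (1 / (2 * pi))) *\<^sub>R x + - ((1 / (1 / (2 * pi))) *\<^sub>R 0)) ` cbox 0 1)"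
    by (rule has_integral_affinity) (use mean_value_unit_circle[OF assms] in auto)
  moreover have "(\<lambda>x. (1 / (1 / (2 * pi))) *\<^sub>R x + - ((1 / (1 / (2 * pi))) *\<^sub>R 0)) ` cbox 0 1 = {0..2 * pi}"
    using image_mult_atLeastAtMost[of "2 * pi" 0 1] by simp
  ultimately show ?thesis by (simp add: scaleR_conv_of_real)
qed

lemma cmod_dilation_less_1:
  assumes "cmod w \<le> 1" "0 \<le> r" "r < 1"
  shows "cmod (of_real r * w) < 1"
  using mult_left_mono[OF assms(1,2)] assms by (simp add: norm_mult)

lemma holomorphic_on_cball_dilation:
  fixes f :: "complex \<Rightarrow> complex"
  assumes "f holomorphic_on ball 0 1" "0 \<le> r" "r < 1"
  shows "(\<lambda>w. f (of_real r * w)) holomorphic_on cball 0 1"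
proof -
  have "(\<lambda>w::complex. of_real r * w) ` cball 0 1 \<subseteq> ball 0 1"
    using assms cmod_dilation_less_1 by auto
  then have "(f \<circ> (\<lambda>w. of_real r * w)) holomorphic_on cball 0 1"
    by (intro holomorphic_on_compose_gen[OF _ assms(1)] holomorphic_intros)
  then show ?thesis by (simp add: o_def)
qed

lemma mean_value_dilated_circle:
  fixes f :: "complex \<Rightarrow> complex"
  assumes "f holomorphic_on ball 0 1" "0 \<le> r" "r < 1"
  shows "((\<lambda>\<theta>. f (of_real r * cis \<theta>)) has_integral 2 * pi * f 0) {0..2 * pi}"
  using mean_value_circle[OF holomorphic_on_imp_continuous_on holomorphic_on_subset[OF _ ball_subset_cball],
      OF holomorphic_on_cball_dilation holomorphic_on_cball_dilation, OF assms assms] by simp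

section \<open>Real parts of polynomials on the circle\<close>

text \<open>Splitting off both constant coefficients leaves a common factor
  \<open>z * cnj z = 1\<close>, which drives the induction. In the remaining terms, taking the real
  part allows conjugation, which folds negative frequencies onto positive ones.\<close>

lemma Re_mult_cnj_poly_on_circle:
  "\<exists>s. \<forall>z. cmod z = 1 \<longrightarrow> Re (poly p z * cnj (poly q z)) = Re (poly s z)"
proof (induction p arbitrary: q rule: pCons_induct)
  case 0
  show ?case by (intro exI[of _ 0]) auto
next
  case (pCons a p)
  show ?case
  proof (cases q)
    case (pCons b q')
    obtain s where s: "\<And>z. cmod z = 1 \<Longrightarrow> Re (poly p z * cnj (poly q' z)) = Re (poly s z)"
      using pCons.IH by blast
    show ?thesis
    proof (intro exI[of _ "smult (cnj a) q + smult (cnj b) (pCons 0 p) + s"] allI impI)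
      fix z :: complex assume z: "cmod z = 1"
      have zz: "z * cnj z = 1" using complex_norm_square[of z] z by simp
      have "poly (pCons a p) z * cnj (poly q z)
          = cnj (cnj a * poly q z) + cnj b * (z * poly p z) + (z * cnj z) * (poly p z * cnj (poly q' z))"
        by (simp add: pCons algebra_simps)
      then have "Re (poly (pCons a p) z * cnj (poly q z))
          = Re (cnj a * poly q z) + Re (cnj b * (z * poly p z)) + Re (poly p z * cnj (poly q' z))"
        unfolding zz by (simp del: poly_pCons)
      also have "\<dots> = Re (poly (smult (cnj a) q + smult (cnj b) (pCons 0 p) + s) z)"
        by (simp add: s[OF z] mult_ac del: times_complex.sel)
      finally show "Re (poly (pCons a p) z * cnj (poly q z)) = \<dots>" .
    qed
  qed
qed

text \<open>The identity \<open>Re a * Re b = (Re (a * b) + Re (a * cnj b)) / 2\<close> closes real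
  parts of polynomials under multiplication, so Stone-Weierstrass becomes available for
  them.\<close>

lemma real_polynomial_function_Re_poly_on_circle:
  assumes "real_polynomial_function (g :: complex \<Rightarrow> real)"
  shows "\<exists>p. \<forall>z. cmod z = 1 \<longrightarrow> g z = Re (poly p z)"
  using assms
proof induction
  case (linear f)
  interpret bounded_linear f by fact
  have "f z = Re (poly [:0, of_real (f 1) - \<i> * of_real (f \<i>):] z)" for z
  proof -
    have "z = Re z *\<^sub>R 1 + Im z *\<^sub>R \<i>" by (simp add: complex_eq_iff)
    then have "f z = Re z * f 1 + Im z * f \<i>" by (metis add scale real_scaleR_def)
    then show ?thesis by (simp add: algebra_simps)
  qed
  then show ?case by blast
next
  case (const c)
  show ?case by (intro exI[of _ "[:of_real c:]"]) simp
next
  case (add f g)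
  then obtain p q where "\<forall>z. cmod z = 1 \<longrightarrow> f z = Re (poly p z)" "\<forall>z. cmod z = 1 \<longrightarrow> g z = Re (poly q z)" by blast
  then show ?case by (intro exI[of _ "p + q"]) simp
next
  case (mult f g)
  then obtain p q where pq: "\<And>z. cmod z = 1 \<Longrightarrow> f z = Re (poly p z)" "\<And>z. cmod z = 1 \<Longrightarrow> g z = Re (poly q z)" by blast
  obtain s where s: "\<And>z. cmod z = 1 \<Longrightarrow> Re (poly p z * cnj (poly q z)) = Re (poly s z)"
    using Re_mult_cnj_poly_on_circle[of p q] by blast
  show ?case
  proof (intro exI[of _ "smult (1/2) (p * q + s)"] allI impI)
    fix z :: complex assume z: "cmod z = 1"
    have "f z * g z = (Re (poly p z * poly q z) + Re (poly p z * cnj (poly q z))) / 2"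
      using pq z by simp
    then show "f z * g z = Re (poly (smult (1/2) (p * q + s)) z)"
      using s[OF z] by (simp add: add_divide_distrib del: times_complex.sel)
  qed
qed

lemma approximation_Re_poly_on_circle:
  fixes u :: "complex \<Rightarrow> real"
  assumes "continuous_on (sphere 0 1) u" "0 < e"
  obtains p where "\<And>z. cmod z = 1 \<Longrightarrow> \<bar>u z - Re (poly p z)\<bar> < e"
proof -
  obtain g where g: "real_polynomial_function g" "\<And>x. x \<in> sphere 0 1 \<Longrightarrow> \<bar>u x - g x\<bar> < e"
    using Stone_Weierstrass_real_polynomial_function[OF compact_sphere assms] by blast
  then show ?thesis
    using real_polynomial_function_Re_poly_on_circle[OF g(1)] that by (metis dist_0_norm mem_sphere)
qed

text \<open>The maximum modulus principle for \<open>f * exp (- p)\<close>: it makes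
  \<open>Re p\<close> a harmonic majorant of \<open>ln |f|\<close> as soon as it is one on the
  circle.\<close>

lemma cmod_le_exp_Re_poly:
  fixes f :: "complex \<Rightarrow> complex"
  assumes cont: "continuous_on (cball 0 1) f" and hol: "f holomorphic_on ball 0 1"
    and bound: "\<And>z. cmod z = 1 \<Longrightarrow> cmod (f z) \<le> exp (Re (poly p z))" and z: "cmod z \<le> 1"
  shows "cmod (f z) \<le> exp (Re (poly p z))"
proof -
  have "cmod (f z * exp (- poly p z)) \<le> 1"
  proof (rule maximum_modulus_frontier[where S = "cball 0 1" and f = "\<lambda>z. f z * exp (- poly p z)"])
    show "(\<lambda>z. f z * exp (- poly p z)) holomorphic_on interior (cball 0 1)"
      unfolding interior_cball by (intro holomorphic_intros hol)
    show "continuous_on (closure (cball 0 1)) (\<lambda>z. f z * exp (- poly p z))"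
      unfolding closure_closed[OF closed_cball] by (intro continuous_intros cont)
    fix w :: complex assume "w \<in> frontier (cball 0 1)"
    then have "cmod w = 1" by simp
    from bound[OF this] show "cmod (f w * exp (- poly p w)) \<le> 1"
      by (simp add: norm_mult norm_divide norm_exp_eq_Re exp_minus field_simps)
  qed (use z in auto)
  then show ?thesis by (simp add: norm_mult norm_divide norm_exp_eq_Re exp_minus field_simps)
qed

text \<open>
  Real parts of polynomials, which are dense in the continuous functions on the circle, play the
  role of the Poisson integral as harmonic majorants.
\<close>

lemma log_mean_mono:
  assumes hol: "f holomorphic_on ball 0 1" and r: "0 \<le> r" "r \<le> R" "R < 1"
  shows "log_mean f r \<le> log_mean f R"
proof (cases "r = R")
  case False
  define s where "s = r / R"
  have R: "0 < R" using False r by simp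
  have s: "0 \<le> s" "s < 1" and rs: "r = s * R" using R r False by (auto simp: s_def)
  define g where "g w = f (of_real R * w)" for w
  have hg': "g holomorphic_on cball 0 1" unfolding g_def
    using hol r R by (intro holomorphic_on_cball_dilation) auto
  have cg: "continuous_on (cball 0 1) g" by (rule holomorphic_on_imp_continuous_on[OF hg'])
  have hg: "g holomorphic_on ball 0 1" by (rule holomorphic_on_subset[OF hg' ball_subset_cball])
  define u where "u w = log_plus (cmod (g w))" for w
  have cu: "continuous_on (cball 0 1) u" unfolding u_def by (intro continuous_intros cg)
  have intu: "(\<lambda>\<theta>. u (of_real t * cis \<theta>)) integrable_on {0..2*pi}" if "0 \<le> t" "t \<le> 1" for t
    by (intro integrable_continuous_real continuous_on_compose2[OF cu] continuous_intros)
      (use that in \<open>auto simp: norm_mult\<close>)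
  have main: "integral {0..2*pi} (\<lambda>\<theta>. u (of_real s * cis \<theta>)) \<le> integral {0..2*pi} (\<lambda>\<theta>. u (cis \<theta>)) + 4 * pi * e"
    if e: "e > 0" for e
  proof -
    \<comment> \<open>Approximating \<open>u + e\<close> within \<open>e\<close> places
      \<open>Re p\<close> between \<open>u\<close> and \<open>u + 2 * e\<close> on the
      circle.\<close>
    have "continuous_on (sphere 0 1) (\<lambda>w. u w + e)"
      by (intro continuous_intros continuous_on_subset[OF cu]) auto
    then obtain p where p: "\<And>z. cmod z = 1 \<Longrightarrow> \<bar>u z + e - Re (poly p z)\<bar> < e"
      using approximation_Re_poly_on_circle[OF _ e] by blast
    have le: "u z \<le> Re (poly p z)" "Re (poly p z) \<le> u z + 2 * e" if "cmod z = 1" for z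
      using p[OF that] by (auto simp: abs_if split: if_splits)
    have "cmod (g z) \<le> exp (Re (poly p z))" if "cmod z \<le> 1" for z
    proof (rule cmod_le_exp_Re_poly[OF cg hg _ that])
      fix w :: complex assume "cmod w = 1"
      then show "cmod (g w) \<le> exp (Re (poly p w))"
        using le(1)[of w] le_exp_log_plus[of "cmod (g w)"] by (smt (verit) exp_le_cancel_iff norm_ge_zero u_def)
    qed
    \<comment> \<open>The constant function 1 yields \<open>0 \<le> Re p\<close> in the disc, the
      second half of majorising \<open>log_plus\<close>.\<close>
    moreover have "cmod 1 \<le> exp (Re (poly p z))" if "cmod z \<le> 1" for z
    proof (rule cmod_le_exp_Re_poly[of "\<lambda>_. 1", OF _ _ _ that])
      fix w :: complex assume "cmod w = 1"
      then show "cmod 1 \<le> exp (Re (poly p w))"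
        using le(1)[of w] log_plus_nonneg[of "cmod (g w)"] by (simp add: u_def)
    qed auto
    ultimately have ule: "u z \<le> Re (poly p z)" if "cmod z \<le> 1" for z
      using that unfolding u_def by (subst log_plus_le_iff) auto
    have hp: "(\<lambda>z. poly p z) holomorphic_on ball 0 1" by (intro holomorphic_intros)
    have cp: "continuous_on (cball 0 1) (\<lambda>z. poly p z)" by (intro continuous_intros)
    have i1: "((\<lambda>\<theta>. Re (poly p (of_real s * cis \<theta>))) has_integral 2 * pi * Re (poly p 0)) {0..2*pi}"
      using has_integral_Re[OF mean_value_dilated_circle[OF hp s]] by simp
    have i2: "((\<lambda>\<theta>. Re (poly p (cis \<theta>))) has_integral 2 * pi * Re (poly p 0)) {0..2*pi}"
      using has_integral_Re[OF mean_value_circle[OF cp hp]] by simp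
    have "integral {0..2*pi} (\<lambda>\<theta>. u (of_real s * cis \<theta>)) \<le> integral {0..2*pi} (\<lambda>\<theta>. Re (poly p (of_real s * cis \<theta>)))"
      by (rule integral_le[OF intu]) (use s i1 ule in \<open>auto simp: norm_mult\<close>)
    also have "\<dots> = integral {0..2*pi} (\<lambda>\<theta>. Re (poly p (cis \<theta>)))"
      using i1 i2 by (simp add: integral_unique)
    also have "\<dots> \<le> integral {0..2*pi} (\<lambda>\<theta>. u (cis \<theta>) + 2 * e)"
      by (rule integral_le) (use i2 le intu[of 1] in \<open>auto intro!: integrable_add\<close>)
    also have "\<dots> = integral {0..2*pi} (\<lambda>\<theta>. u (cis \<theta>)) + 4 * pi * e"
      using intu[of 1] by (subst integral_add) auto
    finally show ?thesis .
  qed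
  have "integral {0..2*pi} (\<lambda>\<theta>. u (of_real s * cis \<theta>)) \<le> integral {0..2*pi} (\<lambda>\<theta>. u (cis \<theta>))"
  proof (rule field_le_epsilon)
    fix e :: real assume "e > 0"
    then show "integral {0..2*pi} (\<lambda>\<theta>. u (of_real s * cis \<theta>)) \<le> integral {0..2*pi} (\<lambda>\<theta>. u (cis \<theta>)) + e"
      using main[of "e / (4 * pi)"] by simp
  qed
  then show ?thesis
    unfolding log_mean_def u_def g_def rs by (simp add: divide_right_mono mult_ac)
qed auto

text \<open>Since the means increase with the radius, their limit exists exactly when they are
  bounded.\<close>

lemma nevanlinna_class_iff:
  "f \<in> nevanlinna_class \<longleftrightarrow> f holomorphic_on ball 0 1 \<and> (\<exists>B. \<forall>r. 0 \<le> r \<and> r < 1 \<longrightarrow> log_mean f r \<le> B)"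
proof safe
  assume f: "f \<in> nevanlinna_class"
  then show hol: "f holomorphic_on ball 0 1" by (simp add: nevanlinna_class_def)
  obtain L where L: "(log_mean f \<longlongrightarrow> L) (at_left 1)" using f by (auto simp: nevanlinna_class_def)
  have "log_mean f r \<le> L" if "0 \<le> r" "r < 1" for r
  proof (rule tendsto_lowerbound[OF L])
    show "\<forall>\<^sub>F x in at_left 1. log_mean f r \<le> log_mean f x"
      by (rule eventually_at_leftI[of r]) (use that log_mean_mono[OF hol] in auto)
  qed simp
  then show "\<exists>B. \<forall>r. 0 \<le> r \<and> r < 1 \<longrightarrow> log_mean f r \<le> B" by blast
next
  fix B assume hol: "f holomorphic_on ball 0 1" and B: "\<forall>r. 0 \<le> r \<and> r < 1 \<longrightarrow> log_mean f r \<le> B"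
  let ?L = "SUP r\<in>{0..<1}. log_mean f r"
  have bdd: "bdd_above (log_mean f ` {0..<1})" using B by (auto simp: bdd_above_def intro!: exI[of _ B])
  have "(log_mean f \<longlongrightarrow> ?L) (at_left 1)"
  proof (rule increasing_tendsto)
    show "\<forall>\<^sub>F r in at_left 1. log_mean f r \<le> ?L"
      by (rule eventually_at_leftI[of 0]) (auto intro!: cSUP_upper bdd)
    fix x assume "x < ?L"
    then obtain r where r: "0 \<le> r" "r < 1" "x < log_mean f r"
      using less_cSUP_iff[of "{0..<1}" "log_mean f" x] bdd by auto
    show "\<forall>\<^sub>F t in at_left 1. x < log_mean f t"
    proof (rule eventually_at_leftI[of r])
      fix t assume "t \<in> {r<..<1}"
      then show "x < log_mean f t" using r log_mean_mono[OF hol, of r t] by simp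
    qed (use r in auto)
  qed
  then show "f \<in> nevanlinna_class" using hol by (auto simp: nevanlinna_class_def)
qed

text \<open>Pointwise \<open>log_plus |h * f| \<le> Re G + log_plus |f|\<close>, and
  \<open>Re G\<close> is harmonic, so its mean over every circle about 0 is
  \<open>Re (G 0)\<close>.\<close>

lemma nevanlinna_class_mult:
  assumes f: "f \<in> nevanlinna_class" and h: "h holomorphic_on ball 0 1" and G: "G holomorphic_on ball 0 1"
    and bound: "\<And>z. cmod z < 1 \<Longrightarrow> 0 \<le> Re (G z) \<and> cmod (h z) \<le> exp (Re (G z))"
  shows "(\<lambda>z. h z * f z) \<in> nevanlinna_class"
proof -
  obtain B where hol: "f holomorphic_on ball 0 1" and B: "\<And>r. 0 \<le> r \<Longrightarrow> r < 1 \<Longrightarrow> log_mean f r \<le> B"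
    using f unfolding nevanlinna_class_iff by blast
  have "log_mean (\<lambda>z. h z * f z) r \<le> Re (G 0) + B" if r: "0 \<le> r" "r < 1" for r
  proof -
    have cont: "continuous_on {0..2*pi} (\<lambda>\<theta>. k (of_real r * cis \<theta>))" if "k holomorphic_on ball 0 1" for k :: "complex \<Rightarrow> complex"
      by (rule continuous_on_compose2[OF holomorphic_on_imp_continuous_on[OF that]])
        (use r in \<open>auto intro!: continuous_intros simp: norm_mult\<close>)
    have iG: "((\<lambda>\<theta>. Re (G (of_real r * cis \<theta>))) has_integral 2 * pi * Re (G 0)) {0..2*pi}"
      using has_integral_Re[OF mean_value_dilated_circle[OF G r]] by simp
    have if': "(\<lambda>\<theta>. log_plus (cmod (f (of_real r * cis \<theta>)))) integrable_on {0..2*pi}"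
      by (intro integrable_continuous_real continuous_intros cont hol)
    have "integral {0..2*pi} (\<lambda>\<theta>. log_plus (cmod (h (of_real r * cis \<theta>) * f (of_real r * cis \<theta>))))
        \<le> integral {0..2*pi} (\<lambda>\<theta>. Re (G (of_real r * cis \<theta>)) + log_plus (cmod (f (of_real r * cis \<theta>))))"
    proof (rule integral_le)
      show "(\<lambda>\<theta>. log_plus (cmod (h (of_real r * cis \<theta>) * f (of_real r * cis \<theta>)))) integrable_on {0..2*pi}"
        by (intro integrable_continuous_real continuous_intros cont hol h)
      show "(\<lambda>\<theta>. Re (G (of_real r * cis \<theta>)) + log_plus (cmod (f (of_real r * cis \<theta>)))) integrable_on {0..2*pi}"
        using iG if' by (intro integrable_add) auto
      fix \<theta> :: real
      show "log_plus (cmod (h (of_real r * cis \<theta>) * f (of_real r * cis \<theta>)))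
          \<le> Re (G (of_real r * cis \<theta>)) + log_plus (cmod (f (of_real r * cis \<theta>)))"
        unfolding norm_mult using bound[of "of_real r * cis \<theta>"] r
        by (intro log_plus_mult_le) (auto simp: norm_mult)
    qed
    also have "\<dots> = 2 * pi * Re (G 0) + integral {0..2*pi} (\<lambda>\<theta>. log_plus (cmod (f (of_real r * cis \<theta>))))"
      using iG if' by (subst integral_add) (auto simp: integral_unique)
    finally have "log_mean (\<lambda>z. h z * f z) r \<le> Re (G 0) + log_mean f r"
      by (simp add: log_mean_def field_simps)
    then show ?thesis using B[OF r] by simp
  qed
  then show ?thesis unfolding nevanlinna_class_iff using hol h by (auto intro!: holomorphic_intros)
qed

section \<open>Products in the Smirnov class\<close>

text \<open>The dominating functions vary with \<open>n\<close>. Truncating \<open>u n\<close> at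
  \<open>h\<close> allows ordinary dominated convergence; the excess is at most the positive part of
  \<open>g n - h\<close>, written as \<open>g n - h + k n\<close>, whose integral tends to
  0.\<close>

lemma generalized_dominated_convergence:
  fixes u g :: "nat \<Rightarrow> 'a \<Rightarrow> real"
  assumes meas [measurable]: "\<And>n. u n \<in> borel_measurable M" "v \<in> borel_measurable M"
    and int: "\<And>n. integrable M (g n)" "integrable M h"
    and dom: "\<And>n. AE x in M. 0 \<le> u n x \<and> u n x \<le> g n x"
    and lim: "AE x in M. (\<lambda>n. u n x) \<longlonglongrightarrow> v x" "AE x in M. (\<lambda>n. g n x) \<longlonglongrightarrow> h x"
    and limint: "(\<lambda>n. integral\<^sup>L M (g n)) \<longlonglongrightarrow> integral\<^sup>L M h"
  shows "integrable M v" and "(\<lambda>n. integral\<^sup>L M (u n)) \<longlonglongrightarrow> integral\<^sup>L M v"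
proof -
  have [measurable]: "g n \<in> borel_measurable M" "h \<in> borel_measurable M" for n
    using int by auto
  have dom': "AE x in M. \<forall>n. 0 \<le> u n x \<and> u n x \<le> g n x"
    using dom by (simp add: AE_all_countable)
  have vh: "AE x in M. 0 \<le> v x \<and> v x \<le> h x"
    using dom' lim
  proof eventually_elim
    case (elim x)
    have "0 \<le> v x" by (rule LIMSEQ_le_const[OF elim(2)]) (use elim(1) in auto)
    moreover have "v x \<le> h x" by (rule LIMSEQ_le[OF elim(2,3)]) (use elim(1) in auto)
    ultimately show ?case by simp
  qed
  show v: "integrable M v"
    by (rule Bochner_Integration.integrable_bound[OF int(2)]) (use vh in auto)
  have u: "integrable M (u n)" for n
    by (rule Bochner_Integration.integrable_bound[OF int(1)[of n]]) (use dom[of n] in auto)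
  define w where "w n x = min (u n x) (h x)" for n x
  define k where "k n x = max 0 (h x - g n x)" for n x
  have [measurable]: "w n \<in> borel_measurable M" "k n \<in> borel_measurable M" for n
    unfolding w_def k_def by measurable
  have iw: "integrable M (w n)" for n unfolding w_def using u int by auto
  have ik: "integrable M (k n)" for n unfolding k_def using int by auto
  have w: "(\<lambda>n. integral\<^sup>L M (w n)) \<longlonglongrightarrow> integral\<^sup>L M v"
  proof (rule integral_dominated_convergence[where w = h])
    show "AE x in M. (\<lambda>n. w n x) \<longlonglongrightarrow> v x" using vh lim
    proof eventually_elim
      case (elim x)
      then have "(\<lambda>n. min (u n x) (h x)) \<longlonglongrightarrow> min (v x) (h x)" by (intro tendsto_min) auto
      then show ?case using elim by (simp add: w_def min_absorb1)
    qed
    show "AE x in M. norm (w n x) \<le> h x" for n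
      using vh dom[of n] by eventually_elim (auto simp: w_def)
  qed (use int in auto)
  have k: "(\<lambda>n. integral\<^sup>L M (k n)) \<longlonglongrightarrow> integral\<^sup>L M (\<lambda>_. 0)"
  proof (rule integral_dominated_convergence[where w = h])
    show "AE x in M. (\<lambda>n. k n x) \<longlonglongrightarrow> 0" using lim(2)
    proof eventually_elim
      case (elim x)
      then have "(\<lambda>n. max 0 (h x - g n x)) \<longlonglongrightarrow> max 0 (h x - h x)" by (intro tendsto_intros)
      then show ?case by (simp add: k_def)
    qed
    show "AE x in M. norm (k n x) \<le> h x" for n
      using vh dom[of n] by eventually_elim (auto simp: k_def)
  qed (use int in auto)
  have lo: "0 \<le> integral\<^sup>L M (\<lambda>x. u n x - w n x)" for n
    by (rule integral_nonneg_AE) (auto simp: w_def)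
  have hi: "integral\<^sup>L M (\<lambda>x. u n x - w n x) \<le> integral\<^sup>L M (g n) - integral\<^sup>L M h + integral\<^sup>L M (k n)" for n
  proof -
    have "integral\<^sup>L M (\<lambda>x. u n x - w n x) \<le> integral\<^sup>L M (\<lambda>x. g n x - h x + k n x)"
    proof (rule integral_mono_AE)
      show "AE x in M. u n x - w n x \<le> g n x - h x + k n x"
        using dom[of n] by eventually_elim (auto simp: w_def k_def)
    qed (use u iw ik int in auto)
    then show ?thesis using u iw ik int by simp
  qed
  have "(\<lambda>n. integral\<^sup>L M (g n) - integral\<^sup>L M h + integral\<^sup>L M (k n)) \<longlonglongrightarrow> integral\<^sup>L M h - integral\<^sup>L M h + integral\<^sup>L M (\<lambda>_. 0 :: real)"
    by (intro tendsto_add tendsto_diff tendsto_const limint k)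
  then have up: "(\<lambda>n. integral\<^sup>L M (g n) - integral\<^sup>L M h + integral\<^sup>L M (k n)) \<longlonglongrightarrow> 0"
    by simp
  have "(\<lambda>n. integral\<^sup>L M (\<lambda>x. u n x - w n x)) \<longlonglongrightarrow> 0"
    by (rule tendsto_sandwich[OF always_eventually always_eventually tendsto_const up]) (use lo hi in blast)+
  from tendsto_add[OF this w] show "(\<lambda>n. integral\<^sup>L M (u n)) \<longlonglongrightarrow> integral\<^sup>L M v"
    using u iw by simp
qed

lemma AE_lebesgue_on_iff_negligible:
  assumes "S \<in> sets lebesgue"
  shows "(AE x in lebesgue_on S. P x) \<longleftrightarrow> negligible {x \<in> S. \<not> P x}"
proof -
  have "(AE x in lebesgue_on S. P x) \<longleftrightarrow> (AE x in lebesgue. x \<in> S \<longrightarrow> P x)"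
    using assms by (intro AE_restrict_space_iff) auto
  also have "\<dots> \<longleftrightarrow> {x \<in> space lebesgue. \<not> (x \<in> S \<longrightarrow> P x)} \<in> null_sets lebesgue"
    by (rule completion.AE_iff_null_sets)
  also have "{x \<in> space lebesgue. \<not> (x \<in> S \<longrightarrow> P x)} = {x \<in> S. \<not> P x}" by auto
  also have "\<dots> \<in> null_sets lebesgue \<longleftrightarrow> negligible {x \<in> S. \<not> P x}"
    by (rule negligible_iff_null_sets[symmetric])
  finally show ?thesis .
qed

lemma AE_lebesgue_on_has_integral:
  fixes f g :: "'a::euclidean_space \<Rightarrow> 'b::real_normed_vector"
  assumes "AE x in lebesgue_on S. f x = g x" "S \<in> sets lebesgue" "(g has_integral I) S"
  shows "(f has_integral I) S"
  by (rule has_integral_spike[OF AE_lebesgue_on_iff_negligible[THEN iffD1, OF assms(2,1)] _ assms(3)]) auto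

lemma nonneg_integrable_on_imp_integrable:
  fixes f :: "'a::euclidean_space \<Rightarrow> real"
  assumes "f integrable_on S" "\<And>x. x \<in> S \<Longrightarrow> 0 \<le> f x" "S \<in> sets lebesgue"
  shows "integrable (lebesgue_on S) f"
  using absolutely_integrable_imp_integrable[OF nonnegative_absolutely_integrable_1] assms by blast

text \<open>One sequence increasing to 1 suffices: Fatou's lemma and dominated convergence concern
  sequences, and limits along the whole left neighbourhood of 1 restrict to it.\<close>

definition radii :: "nat \<Rightarrow> real" where
  "radii n = 1 - inverse (real (Suc n))"

lemma radii_bounds: "0 \<le> radii n" "radii n < 1"
  by (auto simp: radii_def inverse_le_1_iff)

lemma filterlim_radii: "filterlim radii (at_left 1) sequentially"
proof -
  have "radii \<longlonglongrightarrow> 1 - 0" unfolding radii_def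
    by (intro tendsto_intros LIMSEQ_inverse_real_of_nat)
  then show ?thesis
    by (auto simp: filterlim_at intro!: always_eventually radii_bounds less_imp_neq)
qed

text \<open>The radius to \<open>cis \<theta>\<close> lies in the Stolz region of aperture 2,
  because \<open>|r * cis \<theta> - cis \<theta>| = 1 - r\<close>.\<close>

lemma nontangential_limit_imp_radial:
  assumes "nontangential_limit f (cis \<theta>) l"
  shows "((\<lambda>r. f (of_real r * cis \<theta>)) \<longlongrightarrow> l) (at_left 1)"
proof (rule filterlim_compose[where g = f])
  show "(f \<longlongrightarrow> l) (at (cis \<theta>) within stolz_region 2 (cis \<theta>))"
    using assms by (simp add: nontangential_limit_def)
  have "((\<lambda>r. of_real r * cis \<theta>) \<longlongrightarrow> of_real 1 * cis \<theta>) (at_left 1)" by (intro tendsto_intros)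
  moreover have "\<forall>\<^sub>F r in at_left 1. of_real r * cis \<theta> \<in> stolz_region 2 (cis \<theta>) \<and> of_real r * cis \<theta> \<noteq> cis \<theta>"
  proof (rule eventually_at_leftI[of 0])
    fix r :: real assume r: "r \<in> {0<..<1}"
    have "of_real r * cis \<theta> - cis \<theta> = of_real (r - 1) * cis \<theta>" by (simp add: algebra_simps)
    then have "cmod (of_real r * cis \<theta> - cis \<theta>) = 1 - r"
      using r by (simp add: norm_mult del: of_real_diff)
    then show "of_real r * cis \<theta> \<in> stolz_region 2 (cis \<theta>) \<and> of_real r * cis \<theta> \<noteq> cis \<theta>"
      using r by (auto simp: stolz_region_def norm_mult)
  qed simp
  ultimately show "filterlim (\<lambda>r. of_real r * cis \<theta>) (at (cis \<theta>) within stolz_region 2 (cis \<theta>)) (at_left 1)"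
    by (simp add: filterlim_at)
qed

lemma continuous_on_circle:
  fixes f :: "complex \<Rightarrow> complex"
  assumes "f holomorphic_on ball 0 1" "0 \<le> r" "r < 1"
  shows "continuous_on S (\<lambda>\<theta>. f (of_real r * cis \<theta>))"
  by (rule continuous_on_compose2[OF holomorphic_on_imp_continuous_on[OF assms(1)]])
    (use assms in \<open>auto intro!: continuous_intros simp: norm_mult\<close>)

lemma log_mean_eq_lebesgue_integral:
  assumes "f holomorphic_on ball 0 1" "0 \<le> r" "r < 1"
  shows "integrable (lebesgue_on {0..2*pi}) (\<lambda>\<theta>. log_plus (cmod (f (of_real r * cis \<theta>))))"
    and "(\<integral>\<theta>. log_plus (cmod (f (of_real r * cis \<theta>))) \<partial>lebesgue_on {0..2*pi}) = 2 * pi * log_mean f r"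
proof -
  show i: "integrable (lebesgue_on {0..2*pi}) (\<lambda>\<theta>. log_plus (cmod (f (of_real r * cis \<theta>))))"
    by (intro nonneg_integrable_on_imp_integrable integrable_continuous_real continuous_intros
        continuous_on_circle assms log_plus_nonneg) auto
  show "(\<integral>\<theta>. log_plus (cmod (f (of_real r * cis \<theta>))) \<partial>lebesgue_on {0..2*pi}) = 2 * pi * log_mean f r"
    using lebesgue_integral_eq_integral[OF i] by (simp add: log_mean_def)
qed

text \<open>Dominated convergence with the majorants \<open>Re G + log_plus |f|\<close>. Their means
  converge to the mean of the boundary majorant: for \<open>log_plus |f|\<close> this is the Smirnov
  condition, for \<open>Re G\<close> it is the assumption that \<open>W\<close> has the same mean as
  \<open>Re G\<close>.\<close>

lemma smirnov_class_mult:
  assumes f: "f \<in> smirnov_class" and h: "h holomorphic_on ball 0 1" and G: "G holomorphic_on ball 0 1"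
    and bound: "\<And>z. cmod z < 1 \<Longrightarrow> 0 \<le> Re (G z) \<and> cmod (h z) \<le> exp (Re (G z))"
    and H: "boundary_function h H"
    and W: "AE \<theta> in lebesgue_on {0..2*pi}. ((\<lambda>r. Re (G (of_real r * cis \<theta>))) \<longlongrightarrow> W \<theta>) (at_left 1)"
    and W_nonneg: "\<And>\<theta>. 0 \<le> W \<theta>" and W_int: "(W has_integral 2 * pi * Re (G 0)) {0..2*pi}"
  shows "(\<lambda>z. h z * f z) \<in> smirnov_class"
proof -
  let ?M = "lebesgue_on {0..2*pi}"
  let ?c = "\<lambda>n \<theta>. of_real (radii n) * cis \<theta> :: complex"
  obtain F where fN: "f \<in> nevanlinna_class" and F: "boundary_function f F"
    and F_int: "(\<lambda>\<theta>. log_plus (cmod (F (cis \<theta>)))) integrable_on {0..2*pi}"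
    and F_lim: "(log_mean f \<longlongrightarrow> log_mean F 1) (at_left 1)"
    using f by (auto simp: smirnov_class_def)
  have fh: "f holomorphic_on ball 0 1" using fN by (simp add: nevanlinna_class_def)
  have hf: "(\<lambda>z. h z * f z) holomorphic_on ball 0 1" by (intro holomorphic_intros h fh)
  have N: "(\<lambda>z. h z * f z) \<in> nevanlinna_class" by (rule nevanlinna_class_mult[OF fN h G bound])
  then obtain L where L: "(log_mean (\<lambda>z. h z * f z) \<longlongrightarrow> L) (at_left 1)" by (auto simp: nevanlinna_class_def)
  define B where "B \<zeta> = H \<zeta> * F \<zeta>" for \<zeta>
  have B: "boundary_function (\<lambda>z. h z * f z) B"
    using H F unfolding boundary_function_def nontangential_limit_def B_def
    by eventually_elim (auto intro!: tendsto_mult)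
  define u where "u n = (\<lambda>\<theta>. log_plus (cmod (h (?c n \<theta>) * f (?c n \<theta>))))" for n
  define g where "g n = (\<lambda>\<theta>. Re (G (?c n \<theta>)) + log_plus (cmod (f (?c n \<theta>))))" for n
  define k where "k = (\<lambda>\<theta>. W \<theta> + log_plus (cmod (F (cis \<theta>))))"
  \<comment> \<open>As a limit of measurable functions \<open>v\<close> is measurable by
    construction; it agrees almost everywhere with \<open>log_plus |B|\<close>, whose measurability
    is not known beforehand.\<close>
  define v where "v = (\<lambda>\<theta>. lim (\<lambda>n. u n \<theta>))"
  have iu: "integrable ?M (u n)" and Iu: "integral\<^sup>L ?M (u n) = 2 * pi * log_mean (\<lambda>z. h z * f z) (radii n)" for n
    using log_mean_eq_lebesgue_integral[OF hf radii_bounds] by (simp_all add: u_def)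
  have iG: "integrable ?M (\<lambda>\<theta>. Re (G (?c n \<theta>)))" for n
    using bound by (intro nonneg_integrable_on_imp_integrable integrable_continuous_real continuous_intros
        continuous_on_circle G radii_bounds) (auto simp: norm_mult radii_bounds)
  have IG: "(\<integral>\<theta>. Re (G (?c n \<theta>)) \<partial>?M) = 2 * pi * Re (G 0)" for n
    using lebesgue_integral_eq_integral[OF iG[of n]] has_integral_Re[OF mean_value_dilated_circle[OF G radii_bounds[of n]]]
    by (simp add: integral_unique)
  have ig: "integrable ?M (g n)" and Ig: "integral\<^sup>L ?M (g n) = 2 * pi * Re (G 0) + 2 * pi * log_mean f (radii n)" for n
    using iG[of n] IG[of n] log_mean_eq_lebesgue_integral[OF fh radii_bounds[of n]] by (simp_all add: g_def)
  have iW: "integrable ?M W"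
    using W_int W_nonneg by (intro nonneg_integrable_on_imp_integrable) auto
  have iF: "integrable ?M (\<lambda>\<theta>. log_plus (cmod (F (cis \<theta>))))"
    by (intro nonneg_integrable_on_imp_integrable F_int log_plus_nonneg) auto
  have ik: "integrable ?M k" and Ik: "integral\<^sup>L ?M k = 2 * pi * Re (G 0) + 2 * pi * log_mean F 1"
    using iW iF lebesgue_integral_eq_integral[OF iW] lebesgue_integral_eq_integral[OF iF] integral_unique[OF W_int]
    by (simp_all add: k_def log_mean_def)
  have lim_v: "AE \<theta> in ?M. (\<lambda>n. u n \<theta>) \<longlonglongrightarrow> log_plus (cmod (B (cis \<theta>)))"
    using B unfolding boundary_function_def
  proof eventually_elim
    case (elim \<theta>)
    then show ?case unfolding u_def
      using tendsto_log_plus_norm[OF filterlim_compose[OF nontangential_limit_imp_radial[OF elim] filterlim_radii]] by simp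
  qed
  then have eq_v: "AE \<theta> in ?M. log_plus (cmod (B (cis \<theta>))) = v \<theta>"
    by eventually_elim (simp add: v_def limI)
  have lim_v': "AE \<theta> in ?M. (\<lambda>n. u n \<theta>) \<longlonglongrightarrow> v \<theta>"
    using lim_v eq_v by eventually_elim simp
  have lim_k: "AE \<theta> in ?M. (\<lambda>n. g n \<theta>) \<longlonglongrightarrow> k \<theta>"
    using W F unfolding boundary_function_def
  proof eventually_elim
    case (elim \<theta>)
    then show ?case unfolding g_def k_def
      by (intro tendsto_add tendsto_log_plus_norm filterlim_compose[OF _ filterlim_radii] filterlim_compose[OF nontangential_limit_imp_radial filterlim_radii])
  qed
  have dom: "0 \<le> u n \<theta> \<and> u n \<theta> \<le> g n \<theta>" for n \<theta>
    unfolding u_def g_def norm_mult using bound[of "?c n \<theta>"] radii_bounds[of n]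
    by (auto intro!: log_plus_nonneg log_plus_mult_le simp: norm_mult)
  have lim_Ig: "(\<lambda>n. integral\<^sup>L ?M (g n)) \<longlonglongrightarrow> integral\<^sup>L ?M k"
    unfolding Ig Ik by (intro tendsto_intros filterlim_compose[OF F_lim filterlim_radii])
  have [measurable]: "u n \<in> borel_measurable ?M" for n using iu by auto
  have [measurable]: "v \<in> borel_measurable ?M" unfolding v_def by measurable
  have iv: "integrable ?M v" and Iv: "(\<lambda>n. integral\<^sup>L ?M (u n)) \<longlonglongrightarrow> integral\<^sup>L ?M v"
    by (rule generalized_dominated_convergence[where g = g and h = k and u = u and v = v];
        use ig ik lim_v' lim_k dom lim_Ig in auto)+
  have B_int: "((\<lambda>\<theta>. log_plus (cmod (B (cis \<theta>)))) has_integral integral\<^sup>L ?M v) {0..2*pi}"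
    by (rule AE_lebesgue_on_has_integral[OF eq_v _ has_integral_integral_lebesgue_on[OF iv]]) auto
  have "(\<lambda>n. 2 * pi * log_mean (\<lambda>z. h z * f z) (radii n)) \<longlonglongrightarrow> 2 * pi * log_mean B 1"
    using Iv B_int by (simp add: Iu log_mean_def integral_unique)
  then have "(\<lambda>n. log_mean (\<lambda>z. h z * f z) (radii n)) \<longlonglongrightarrow> log_mean B 1"
    by (simp add: tendsto_mult_left_iff)
  \<comment> \<open>Membership in the Nevanlinna class already provides the full limit
    \<open>L\<close>, so the sequence of radii is enough to identify it.\<close>
  then have "L = log_mean B 1"
    using filterlim_compose[OF L filterlim_radii] LIMSEQ_unique by blast
  then show ?thesis
    using N B B_int L by (auto simp: smirnov_class_def)
qed

section \<open>Boundary values of quasi-bounded harmonic functions\<close>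

text \<open>Recovers a limit of \<open>Re G\<close> as \<open>- ln |l|\<close>. The value
  \<open>l = 0\<close> would force \<open>Re G\<close> to tend to infinity along the radii, against
  the finite lower limit.\<close>

lemma radial_limit_Re_cases:
  assumes E: "((\<lambda>r. exp (- G (of_real r * cis \<theta>))) \<longlongrightarrow> l) (at_left 1)"
    and fin: "liminf (\<lambda>n. ennreal (Re (G (of_real (radii n) * cis \<theta>)))) \<noteq> \<infinity>"
  shows "\<exists>w. ((\<lambda>r. Re (G (of_real r * cis \<theta>))) \<longlongrightarrow> w) (at_left 1)"
proof -
  let ?w = "\<lambda>r. Re (G (of_real r * cis \<theta>))"
  have E': "((\<lambda>r. exp (- ?w r)) \<longlongrightarrow> cmod l) (at_left 1)"
    using tendsto_norm[OF E] by (simp add: norm_exp_eq_Re)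
  have "l \<noteq> 0"
  proof
    assume "l = 0"
    with E' have "((\<lambda>r. exp (- ?w r)) \<longlongrightarrow> 0) (at_left 1)" by simp
    from filterlim_compose[OF this filterlim_radii]
    have 0: "(\<lambda>n. exp (- ?w (radii n))) \<longlonglongrightarrow> 0" .
    have "ennreal C \<le> liminf (\<lambda>n. ennreal (?w (radii n)))" for C
    proof (rule Liminf_bounded)
      have "\<forall>\<^sub>F n in sequentially. exp (- ?w (radii n)) < exp (- C)"
        by (rule order_tendstoD(2)[OF 0]) simp
      then show "\<forall>\<^sub>F n in sequentially. ennreal C \<le> ennreal (?w (radii n))"
        by eventually_elim (auto intro: ennreal_leI)
    qed
    moreover obtain x where x: "liminf (\<lambda>n. ennreal (?w (radii n))) = ennreal x" "0 \<le> x"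
      using fin by (cases "liminf (\<lambda>n. ennreal (?w (radii n)))") auto
    ultimately have "ennreal (x + 1) \<le> ennreal x" by metis
    then show False using x(2) by (simp add: ennreal_le_iff)
  qed
  then have "((\<lambda>r. - ln (exp (- ?w r))) \<longlongrightarrow> - ln (cmod l)) (at_left 1)"
    by (intro tendsto_intros E') auto
  then show ?thesis by auto
qed

corollary Fatou_bounded_holomorphic_AE:
  assumes "f holomorphic_on ball 0 1" "\<And>z. cmod z < 1 \<Longrightarrow> cmod (f z) \<le> M"
  shows "AE \<theta> in lebesgue_on {0..2*pi}. \<exists>l. nontangential_limit f (cis \<theta>) l"
proof -
  have "negligible {\<theta>. \<nexists>l. nontangential_limit f (cis \<theta>) l}"
    by (rule Fatou_bounded_holomorphic[OF assms(1), of M]) (use assms(2) in simp)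
  then have "negligible {\<theta> \<in> {0..2*pi}. \<nexists>l. nontangential_limit f (cis \<theta>) l}"
    by (rule negligible_subset) blast
  then show ?thesis by (subst AE_lebesgue_on_iff_negligible) auto
qed

text \<open>Radial limits exist because \<open>exp (- G)\<close> is bounded and Fatou's lemma makes
  the lower limits finite almost everywhere. A singular part of the boundary measure could make the
  mean of \<open>W\<close> smaller than \<open>Re (G 0)\<close>; the minorants \<open>P\<close>,
  continuous up to the circle, rule this out.\<close>

lemma quasi_bounded_boundary_values:
  assumes G: "G holomorphic_on ball 0 1" and nonneg: "\<And>z. cmod z < 1 \<Longrightarrow> 0 \<le> Re (G z)"
    and approx: "\<And>e. 0 < e \<Longrightarrow> \<exists>P. continuous_on (cball 0 1) P \<and> P holomorphic_on ball 0 1 \<and>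
      (\<forall>z. cmod z < 1 \<longrightarrow> Re (P z) \<le> Re (G z)) \<and> Re (G 0) - e < Re (P 0)"
  obtains W where "\<And>\<theta>. 0 \<le> W \<theta>" "(W has_integral 2 * pi * Re (G 0)) {0..2*pi}"
    "AE \<theta> in lebesgue_on {0..2*pi}. ((\<lambda>r. Re (G (of_real r * cis \<theta>))) \<longlongrightarrow> W \<theta>) (at_left 1)"
proof -
  let ?M = "lebesgue_on {0..2*pi}"
  define w where "w n = (\<lambda>\<theta>. Re (G (of_real (radii n) * cis \<theta>)))" for n
  have w0: "0 \<le> w n \<theta>" for n \<theta>
    unfolding w_def using radii_bounds[of n] by (intro nonneg) (simp add: norm_mult)
  have iw: "integrable ?M (w n)" for n
    unfolding w_def using w0[unfolded w_def]
    by (intro nonneg_integrable_on_imp_integrable integrable_continuous_real continuous_intros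
        continuous_on_circle G radii_bounds) auto
  have Iw: "integral\<^sup>L ?M (w n) = 2 * pi * Re (G 0)" for n
    using lebesgue_integral_eq_integral[OF iw[of n]] has_integral_Re[OF mean_value_dilated_circle[OF G radii_bounds[of n]]]
    by (simp add: w_def integral_unique)
  have [measurable]: "w n \<in> borel_measurable ?M" for n using iw by auto
  have "(\<integral>\<^sup>+\<theta>. liminf (\<lambda>n. ennreal (w n \<theta>)) \<partial>?M) \<le> liminf (\<lambda>n. \<integral>\<^sup>+\<theta>. ennreal (w n \<theta>) \<partial>?M)"
    by (rule nn_integral_liminf) measurable
  also have "\<dots> = ennreal (2 * pi * Re (G 0))"
    using iw w0 by (simp add: nn_integral_eq_integral Iw Liminf_const)
  finally have fatou: "(\<integral>\<^sup>+\<theta>. liminf (\<lambda>n. ennreal (w n \<theta>)) \<partial>?M) \<le> ennreal (2 * pi * Re (G 0))" .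
  then have "(\<integral>\<^sup>+\<theta>. liminf (\<lambda>n. ennreal (w n \<theta>)) \<partial>?M) \<noteq> \<infinity>"
    by (auto simp: top_unique)
  then have fin: "AE \<theta> in ?M. liminf (\<lambda>n. ennreal (w n \<theta>)) \<noteq> \<infinity>"
    by (intro nn_integral_PInf_AE) measurable
  have "AE \<theta> in ?M. \<exists>l. nontangential_limit (\<lambda>z. exp (- G z)) (cis \<theta>) l"
    by (rule Fatou_bounded_holomorphic_AE[where M = 1]) (use G nonneg in \<open>auto intro!: holomorphic_intros\<close>)
  with fin have lim: "AE \<theta> in ?M. \<exists>v. ((\<lambda>r. Re (G (of_real r * cis \<theta>))) \<longlongrightarrow> v) (at_left 1)"
    by eventually_elim (auto simp: w_def dest: nontangential_limit_imp_radial intro: radial_limit_Re_cases)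
  \<comment> \<open>Here \<open>lim\<close> makes \<open>W\<close> measurable, and
    \<open>max 0\<close> makes it nonnegative also at the exceptional angles where
    \<open>lim\<close> is an arbitrary default.\<close>
  define W where "W = (\<lambda>\<theta>. max 0 (lim (\<lambda>n. w n \<theta>)))"
  have limW: "AE \<theta> in ?M. ((\<lambda>r. Re (G (of_real r * cis \<theta>))) \<longlongrightarrow> W \<theta>) (at_left 1)" using lim
  proof eventually_elim
    case (elim \<theta>)
    then obtain v where v: "((\<lambda>r. Re (G (of_real r * cis \<theta>))) \<longlongrightarrow> v) (at_left 1)" by blast
    have n: "(\<lambda>n. w n \<theta>) \<longlonglongrightarrow> v" unfolding w_def by (rule filterlim_compose[OF v filterlim_radii])
    have "0 \<le> v" by (rule LIMSEQ_le_const[OF n]) (use w0 in auto)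
    then show ?case using v limI[OF n] by (simp add: W_def)
  qed
  have limW': "AE \<theta> in ?M. (\<lambda>n. w n \<theta>) \<longlonglongrightarrow> W \<theta>" using limW
    by eventually_elim (auto simp: w_def intro: filterlim_compose[OF _ filterlim_radii])
  have [measurable]: "W \<in> borel_measurable ?M" unfolding W_def by measurable
  have W0: "0 \<le> W \<theta>" for \<theta> by (simp add: W_def)
  have "(\<integral>\<^sup>+\<theta>. ennreal (W \<theta>) \<partial>?M) = (\<integral>\<^sup>+\<theta>. liminf (\<lambda>n. ennreal (w n \<theta>)) \<partial>?M)"
  proof (rule nn_integral_cong_AE)
    show "AE \<theta> in ?M. ennreal (W \<theta>) = liminf (\<lambda>n. ennreal (w n \<theta>))" using limW'
      by eventually_elim (auto intro!: lim_imp_Liminf[symmetric] tendsto_ennrealI)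
  qed
  with fatou have nnW: "(\<integral>\<^sup>+\<theta>. ennreal (W \<theta>) \<partial>?M) \<le> ennreal (2 * pi * Re (G 0))" by simp
  have iW: "integrable ?M W"
    by (rule integrableI_nonneg) (use W0 nnW in \<open>auto simp: less_top[symmetric] top_unique\<close>)
  have G0: "0 \<le> Re (G 0)" using nonneg[of 0] by simp
  have "ennreal (integral\<^sup>L ?M W) \<le> ennreal (2 * pi * Re (G 0))"
    using nnW iW W0 by (simp add: nn_integral_eq_integral)
  then have upper: "integral\<^sup>L ?M W \<le> 2 * pi * Re (G 0)"
    using G0 by (simp add: ennreal_le_iff)
  have "2 * pi * Re (G 0) \<le> integral\<^sup>L ?M W + e" if e: "e > 0" for e
  proof -
    have "0 < e / (2 * pi)" using e by simp
    then obtain P where P: "continuous_on (cball 0 1) P" "P holomorphic_on ball 0 1"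
      "\<And>z. cmod z < 1 \<Longrightarrow> Re (P z) \<le> Re (G z)" "Re (G 0) - e / (2 * pi) < Re (P 0)"
      using approx by blast
    have I: "((\<lambda>\<theta>. Re (P (cis \<theta>))) has_integral 2 * pi * Re (P 0)) {0..2*pi}"
      using has_integral_Re[OF mean_value_circle[OF P(1,2)]] by simp
    have cP: "continuous_on {0..2*pi} (\<lambda>\<theta>. Re (P (cis \<theta>)))"
      by (intro continuous_intros continuous_on_compose2[OF P(1)]) auto
    have iP: "integrable ?M (\<lambda>\<theta>. Re (P (cis \<theta>)))"
      by (intro absolutely_integrable_imp_integrable absolutely_integrable_continuous_real cP) auto
    have "2 * pi * Re (P 0) = integral\<^sup>L ?M (\<lambda>\<theta>. Re (P (cis \<theta>)))"
      using lebesgue_integral_eq_integral[OF iP] I by (simp add: integral_unique)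
    also have "\<dots> \<le> integral\<^sup>L ?M W"
    proof (rule integral_mono_AE[OF iP iW])
      show "AE \<theta> in ?M. Re (P (cis \<theta>)) \<le> W \<theta>" using limW'
      proof eventually_elim
        case (elim \<theta>)
        have "(\<lambda>n. of_real (radii n) * cis \<theta>) \<longlonglongrightarrow> of_real 1 * cis \<theta>"
          using filterlim_radii by (intro tendsto_intros) (auto simp: filterlim_at)
        then have "(\<lambda>n. P (of_real (radii n) * cis \<theta>)) \<longlonglongrightarrow> P (cis \<theta>)"
          by (intro continuous_on_tendsto_compose[OF P(1)])
            (auto simp: norm_mult radii_bounds less_imp_le)
        then have "(\<lambda>n. Re (P (of_real (radii n) * cis \<theta>))) \<longlonglongrightarrow> Re (P (cis \<theta>))" by (rule tendsto_Re)
        then show ?case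
        proof (rule LIMSEQ_le[OF _ elim])
          show "\<exists>N. \<forall>n\<ge>N. Re (P (of_real (radii n) * cis \<theta>)) \<le> w n \<theta>"
            unfolding w_def using radii_bounds by (intro exI[of _ 0] allI impI P(3)) (simp add: norm_mult)
        qed
      qed
    qed
    finally have "2 * pi * Re (P 0) \<le> integral\<^sup>L ?M W" .
    moreover have "2 * pi * (Re (G 0) - e / (2 * pi)) < 2 * pi * Re (P 0)"
      using P(4) by (intro mult_strict_left_mono) auto
    ultimately show ?thesis by (simp add: algebra_simps)
  qed
  then have "2 * pi * Re (G 0) \<le> integral\<^sup>L ?M W" by (rule field_le_epsilon)
  with upper have "integral\<^sup>L ?M W = 2 * pi * Re (G 0)" by simp
  then have "(W has_integral 2 * pi * Re (G 0)) {0..2*pi}"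
    using has_integral_integral_lebesgue_on[OF iW] by simp
  then show ?thesis using that W0 limW by blast
qed

section \<open>Herglotz sums\<close>

text \<open>The points \<open>w\<close> lie inside the disc, so the pole \<open>1 / cnj w\<close> of
  a term (none if \<open>w = 0\<close>) is outside the closed disc and finite partial sums extend
  continuously to the circle.\<close>

definition herglotz_sum :: "(complex \<Rightarrow> real) \<Rightarrow> complex set \<Rightarrow> complex \<Rightarrow> complex" where
  "herglotz_sum m \<Lambda> z = (\<Sum>\<^sub>\<infinity>w\<in>\<Lambda>. of_real (m w) * ((1 + cnj w * z) / (1 - cnj w * z)))"

lemma cmod_herglotz_term_le:
  assumes "cmod w \<le> 1" "cmod z \<le> R" "R < 1"
  shows "cmod ((1 + cnj w * z) / (1 - cnj w * z)) \<le> 2 / (1 - R)"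
proof -
  have v: "cmod (cnj w * z) \<le> R"
    using mult_left_le_one_le[of "cmod z" "cmod w"] assms by (simp add: norm_mult)
  have "cmod (1 + cnj w * z) \<le> 1 + cmod (cnj w * z)" using norm_triangle_ineq[of 1 "cnj w * z"] by simp
  then have "cmod (1 + cnj w * z) \<le> 2" using v assms by linarith
  moreover have "1 - R \<le> cmod (1 - cnj w * z)" using norm_triangle_ineq2[of 1 "cnj w * z"] v by simp
  ultimately show ?thesis unfolding norm_divide using assms by (intro frac_le) auto
qed

lemma one_minus_cnj_mult_nonzero':
  assumes "cmod w < 1" "cmod z < 1"
  shows "1 - cnj w * z \<noteq> 0"
  using assms one_minus_cnj_mult_nonzero[of w z] by simp

context
  fixes m :: "complex \<Rightarrow> real" and \<Lambda> :: "complex set"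
  assumes \<Lambda>: "\<Lambda> \<subseteq> ball 0 1" and m: "\<And>w. w \<in> \<Lambda> \<Longrightarrow> 0 \<le> m w" and sm: "m summable_on \<Lambda>"
begin

lemma herglotz_sum_uniform_limit:
  assumes "R < 1"
  shows "uniform_limit (cball 0 R) (\<lambda>F z. \<Sum>w\<in>F. of_real (m w) * ((1 + cnj w * z) / (1 - cnj w * z)))
    (herglotz_sum m \<Lambda>) (finite_subsets_at_top \<Lambda>)"
proof -
  have "uniform_limit (cball 0 R) (\<lambda>F z. \<Sum>w\<in>F. of_real (m w) * ((1 + cnj w * z) / (1 - cnj w * z)))
    (\<lambda>z. \<Sum>\<^sub>\<infinity>w\<in>\<Lambda>. of_real (m w) * ((1 + cnj w * z) / (1 - cnj w * z))) (finite_subsets_at_top \<Lambda>)"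
  proof (rule Weierstrass_m_test_general[where M = "\<lambda>w. 2 / (1 - R) * m w"])
    fix w z :: complex assume wz: "w \<in> \<Lambda>" "z \<in> cball 0 R"
    have "m w * cmod ((1 + cnj w * z) / (1 - cnj w * z)) \<le> m w * (2 / (1 - R))"
      by (intro mult_left_mono cmod_herglotz_term_le) (use wz \<Lambda> m assms in \<open>auto simp: subset_iff less_imp_le\<close>)
    then show "cmod (of_real (m w) * ((1 + cnj w * z) / (1 - cnj w * z))) \<le> 2 / (1 - R) * m w"
      unfolding norm_mult norm_of_real abs_of_nonneg[OF m[OF wz(1)]] mult.commute[of "2 / (1 - R)" "m w"] .
  qed (intro summable_on_cmult_right sm)
  then show ?thesis by (simp add: herglotz_sum_def[abs_def])
qed

lemma herglotz_sum_holomorphic: "herglotz_sum m \<Lambda> holomorphic_on ball 0 1"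
proof -
  have hol: "herglotz_sum m \<Lambda> holomorphic_on ball 0 R" if "R < 1" for R
  proof (rule holomorphic_uniform_limit[OF _ herglotz_sum_uniform_limit[OF that]])
    show "\<forall>\<^sub>F F in finite_subsets_at_top \<Lambda>.
       continuous_on (cball 0 R) (\<lambda>z. \<Sum>w\<in>F. of_real (m w) * ((1 + cnj w * z) / (1 - cnj w * z))) \<and>
       (\<lambda>z. \<Sum>w\<in>F. of_real (m w) * ((1 + cnj w * z) / (1 - cnj w * z))) holomorphic_on ball 0 R"
    proof (rule eventually_finite_subsets_at_top_weakI)
      fix F assume "F \<subseteq> \<Lambda>"
      then have *: "(\<lambda>z. \<Sum>w\<in>F. of_real (m w) * ((1 + cnj w * z) / (1 - cnj w * z))) holomorphic_on cball 0 R"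
        by (intro holomorphic_intros one_minus_cnj_mult_nonzero')
          (use \<Lambda> \<open>R < 1\<close> in \<open>auto simp: subset_iff\<close>)
      show "continuous_on (cball 0 R) (\<lambda>z. \<Sum>w\<in>F. of_real (m w) * ((1 + cnj w * z) / (1 - cnj w * z))) \<and>
         (\<lambda>z. \<Sum>w\<in>F. of_real (m w) * ((1 + cnj w * z) / (1 - cnj w * z))) holomorphic_on ball 0 R"
        using holomorphic_on_imp_continuous_on[OF *] holomorphic_on_subset[OF * ball_subset_cball] by simp
    qed
  qed auto
  have "\<exists>f'. (herglotz_sum m \<Lambda> has_field_derivative f') (at z)" if z: "z \<in> ball 0 1" for z
  proof -
    have "z \<in> ball 0 ((1 + cmod z) / 2)" "(1 + cmod z) / 2 < 1" using z by auto
    then show ?thesis using hol holomorphic_on_open[OF open_ball] by blast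
  qed
  then show ?thesis using holomorphic_on_open[OF open_ball] by blast
qed

lemma herglotz_sum_has_sum:
  assumes "cmod z < 1"
  shows "((\<lambda>w. of_real (m w) * ((1 + cnj w * z) / (1 - cnj w * z))) has_sum herglotz_sum m \<Lambda> z) \<Lambda>"
  using tendsto_uniform_limitI[OF herglotz_sum_uniform_limit[OF assms], of z] by (simp add: has_sum_def)

lemma Re_herglotz_sum_has_sum:
  assumes "cmod z < 1"
  shows "((\<lambda>w. m w * Re ((1 + cnj w * z) / (1 - cnj w * z))) has_sum Re (herglotz_sum m \<Lambda> z)) \<Lambda>"
proof -
  have "Re (of_real (m w) * ((1 + cnj w * z) / (1 - cnj w * z))) = m w * Re ((1 + cnj w * z) / (1 - cnj w * z))" for w
    by (simp del: times_divide_eq_right)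
  with has_sum_Re[OF herglotz_sum_has_sum[OF assms]] show ?thesis by (simp only:)
qed

lemma Re_herglotz_term_nonneg:
  assumes "w \<in> \<Lambda>" "cmod z < 1"
  shows "0 \<le> m w * Re ((1 + cnj w * z) / (1 - cnj w * z))"
proof -
  have "cmod (cnj w * z) \<le> cmod z"
    using mult_left_le_one_le[of "cmod z" "cmod w"] assms(1) \<Lambda> by (auto simp: norm_mult subset_iff less_imp_le)
  then have v: "cmod (cnj w * z) < 1" using assms by simp
  have "(cmod (cnj w * z))\<^sup>2 \<le> 1" using v by (simp add: abs_square_le_1)
  then have "0 \<le> Re ((1 + cnj w * z) / (1 - cnj w * z))"
    unfolding herglotz_kernel[OF v] by (intro divide_nonneg_nonneg) auto
  then show ?thesis using m[OF assms(1)] by simp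
qed

lemma Re_herglotz_partial_sum_le:
  assumes "F \<subseteq> \<Lambda>" "finite F" "cmod z < 1"
  shows "(\<Sum>w\<in>F. m w * Re ((1 + cnj w * z) / (1 - cnj w * z))) \<le> Re (herglotz_sum m \<Lambda> z)"
  by (rule finite_sum_le_has_sum[OF Re_herglotz_sum_has_sum])
    (use assms Re_herglotz_term_nonneg in auto)

lemma Re_herglotz_sum_nonneg:
  assumes "cmod z < 1"
  shows "0 \<le> Re (herglotz_sum m \<Lambda> z)"
  using Re_herglotz_partial_sum_le[of "{}" z] assms by simp

text \<open>Finite partial sums are the continuous minorants: the omitted terms have nonnegative
  real part, and at 0 every kernel equals 1, so the defect there is \<open>c\<close> times a tail of
  the sum of \<open>m\<close>.\<close>

lemma herglotz_sum_quasi_bounded: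
  assumes c: "0 < c" and K: "0 \<le> K"
  defines "G \<equiv> \<lambda>z. of_real c * herglotz_sum m \<Lambda> z + of_real K"
  obtains W where "\<And>\<theta>. 0 \<le> W \<theta>" "(W has_integral 2 * pi * Re (G 0)) {0..2*pi}"
    "AE \<theta> in lebesgue_on {0..2*pi}. ((\<lambda>r. Re (G (of_real r * cis \<theta>))) \<longlongrightarrow> W \<theta>) (at_left 1)"
proof (rule quasi_bounded_boundary_values[of G])
  show "G holomorphic_on ball 0 1" unfolding G_def by (intro holomorphic_intros herglotz_sum_holomorphic)
  show "0 \<le> Re (G z)" if "cmod z < 1" for z
    unfolding G_def using c K Re_herglotz_sum_nonneg[OF that] by simp
  fix e :: real assume e: "0 < e"
  define S where "S F z = (\<Sum>w\<in>F. of_real (m w) * ((1 + cnj w * z) / (1 - cnj w * z)))" for F z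
  have ReS: "Re (S F z) = (\<Sum>w\<in>F. m w * Re ((1 + cnj w * z) / (1 - cnj w * z)))" for F z
    by (simp add: S_def del: times_divide_eq_right)
  \<comment> \<open>After multiplication by \<open>c\<close> the error is at most
    \<open>e / 2\<close>, which leaves room for the strict inequality.\<close>
  have "0 < e / (2 * c)" using e c by simp
  then obtain F where F: "finite F" "F \<subseteq> \<Lambda>" "dist (sum (\<lambda>w. m w * Re ((1 + cnj w * 0) / (1 - cnj w * 0))) F) (Re (herglotz_sum m \<Lambda> 0)) \<le> e / (2 * c)"
    using has_sum_finite_approximation[OF Re_herglotz_sum_has_sum[of 0]] by force
  have d: "\<bar>Re (S F 0) - Re (herglotz_sum m \<Lambda> 0)\<bar> \<le> e / (2 * c)"
    using F(3) unfolding ReS dist_real_def .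
  show "\<exists>P. continuous_on (cball 0 1) P \<and> P holomorphic_on ball 0 1 \<and>
      (\<forall>z. cmod z < 1 \<longrightarrow> Re (P z) \<le> Re (G z)) \<and> Re (G 0) - e < Re (P 0)"
  proof (intro exI[of _ "\<lambda>z. of_real c * S F z + of_real K"] conjI allI impI)
    have nz: "1 - cnj w * z \<noteq> 0" if "w \<in> F" "cmod z \<le> 1" for w z
      using one_minus_cnj_mult_nonzero[of w z] that F \<Lambda> by auto
    have hS: "(\<lambda>z. of_real c * S F z + of_real K) holomorphic_on cball 0 1"
      unfolding S_def by (intro holomorphic_intros nz) auto
    then show "continuous_on (cball 0 1) (\<lambda>z. of_real c * S F z + of_real K)"
      by (rule holomorphic_on_imp_continuous_on)
    show "(\<lambda>z. of_real c * S F z + of_real K) holomorphic_on ball 0 1"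
      by (rule holomorphic_on_subset[OF hS ball_subset_cball])
    show "Re (of_real c * S F z + of_real K) \<le> Re (G z)" if "cmod z < 1" for z
      using mult_left_mono[OF Re_herglotz_partial_sum_le[OF F(2,1) that], of c] c unfolding G_def by (simp add: ReS)
    have "c * Re (herglotz_sum m \<Lambda> 0) \<le> c * (Re (S F 0) + e / (2 * c))"
      using d c by (intro mult_left_mono) (auto simp: abs_le_iff)
    also have "\<dots> = c * Re (S F 0) + e / 2" using c by (simp add: field_simps)
    finally show "Re (G 0) - e < Re (of_real c * S F 0 + of_real K)"
      using e by (simp add: G_def)
  qed
qed (use that in blast)

end

section \<open>Pseudohyperbolic distance and separation\<close>

lemma one_minus_pseudohyperbolic_sq:
  assumes "cmod z < 1" "cmod w < 1"
  shows "1 - (pseudohyperbolic z w)\<^sup>2 = (1 - (cmod z)\<^sup>2) * (1 - (cmod w)\<^sup>2) / (cmod (1 - cnj w * z))\<^sup>2"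
proof -
  have n: "(cmod (1 - cnj w * z))\<^sup>2 \<noteq> 0" using one_minus_cnj_mult_nonzero'[of w z] assms by simp
  have "(cmod (1 - cnj w * z))\<^sup>2 - (cmod (z - w))\<^sup>2 = (1 - (cmod z)\<^sup>2) * (1 - (cmod w)\<^sup>2)"
    unfolding cmod_power2 by (simp add: power2_eq_square algebra_simps)
  moreover have "(pseudohyperbolic z w)\<^sup>2 = (cmod (z - w))\<^sup>2 / (cmod (1 - cnj w * z))\<^sup>2"
    by (simp add: pseudohyperbolic_def norm_divide power_divide mult.commute)
  moreover have "1 - a / b = (b - a) / b" if "b \<noteq> 0" for a b :: real
    using that by (simp add: diff_divide_distrib)
  ultimately show ?thesis using n by simp
qed

lemma pseudohyperbolic_le_1:
  assumes "cmod z < 1" "cmod w < 1"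
  shows "pseudohyperbolic z w \<le> 1"
proof -
  have "0 \<le> 1 - (pseudohyperbolic z w)\<^sup>2"
    unfolding one_minus_pseudohyperbolic_sq[OF assms] using assms
    by (intro divide_nonneg_nonneg mult_nonneg_nonneg) (auto simp: abs_square_le_1)
  then show ?thesis using abs_square_le_1[of "pseudohyperbolic z w"] by auto
qed

lemma separated_lower_bound:
  assumes "separated \<Lambda>"
  obtains \<delta> where "0 < \<delta>" "\<And>z w. z \<in> \<Lambda> \<Longrightarrow> w \<in> \<Lambda> \<Longrightarrow> z \<noteq> w \<Longrightarrow> \<delta> \<le> pseudohyperbolic z w"
proof -
  \<comment> \<open>A real number strictly below the infimum, which may be infinite when \<Lambda>
    has at most one point.\<close>
  obtain \<delta> where \<delta>: "0 < ereal \<delta>"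
    "ereal \<delta> < (INF (z, w) \<in> {(z, w). z \<in> \<Lambda> \<and> w \<in> \<Lambda> \<and> z \<noteq> w}. ereal (pseudohyperbolic z w))"
    using ereal_dense2[OF assms[unfolded separated_def]] by blast
  show ?thesis
  proof (rule that[of \<delta>])
    fix z w assume "z \<in> \<Lambda>" "w \<in> \<Lambda>" "z \<noteq> w"
    then have "ereal \<delta> < ereal (pseudohyperbolic z w)"
      using less_INF_D[OF \<delta>(2), of "(z, w)"] by simp
    then show "\<delta> \<le> pseudohyperbolic z w" by simp
  qed (use \<delta> in simp)
qed

text \<open>The chain \<open>- ln \<rho> \<le> 1 / \<rho> - 1 = (1 - \<rho>) / \<rho> \<le> (1 -
  \<rho>\<^sup>2) / \<delta>\<close>; separation thus supplies the constant
  \<open>1 / \<delta>\<close> of the interpolation argument.\<close>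

lemma exp_neg_le_of_lower_bound:
  fixes \<rho> :: real
  assumes "0 < \<delta>" "\<delta> \<le> \<rho>" "\<rho> \<le> 1"
  shows "exp (- ((1 - \<rho>\<^sup>2) / \<delta>)) \<le> \<rho>"
proof -
  have \<rho>: "0 < \<rho>" using assms by simp
  have "- ln \<rho> = ln (1 / \<rho>)" using \<rho> by (simp add: ln_div)
  also have "\<dots> \<le> 1 / \<rho> - 1" using \<rho> by (intro ln_le_minus_one) auto
  also have "\<dots> = (1 - \<rho>) / \<rho>" using \<rho> by (simp add: field_simps)
  also have "\<dots> \<le> (1 - \<rho>\<^sup>2) / \<delta>"
  proof (rule frac_le)
    have "\<rho>\<^sup>2 \<le> \<rho>" using mult_left_le_one_le[of \<rho> \<rho>] assms \<rho> by (simp add: power2_eq_square)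
    then show "1 - \<rho> \<le> 1 - \<rho>\<^sup>2" "0 \<le> 1 - \<rho>\<^sup>2" using assms by auto
  qed (use assms in auto)
  finally have "exp (- ((1 - \<rho>\<^sup>2) / \<delta>)) \<le> exp (ln \<rho>)" by simp
  then show ?thesis using \<rho> by simp
qed

section \<open>Interpolation by bounded functions\<close>

text \<open>The factors carry no unimodular normalisation: only moduli, zeros and quotients of
  values are used, and finite products raise no question of convergence.\<close>

definition finite_blaschke :: "complex set \<Rightarrow> complex \<Rightarrow> complex" where
  "finite_blaschke F z = (\<Prod>w\<in>F. (z - w) / (1 - cnj w * z))"

lemma finite_blaschke_holomorphic:
  "F \<subseteq> ball 0 1 \<Longrightarrow> finite_blaschke F holomorphic_on ball 0 1"
  unfolding finite_blaschke_def[abs_def]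
  by (intro holomorphic_intros one_minus_cnj_mult_nonzero') (auto simp: subset_iff)

lemma cmod_finite_blaschke: "cmod (finite_blaschke F z) = (\<Prod>w\<in>F. pseudohyperbolic z w)"
  by (simp add: finite_blaschke_def pseudohyperbolic_def prod_norm mult.commute)

lemma cmod_finite_blaschke_le_1:
  assumes "F \<subseteq> ball 0 1" "cmod z < 1"
  shows "cmod (finite_blaschke F z) \<le> 1"
  unfolding cmod_finite_blaschke
  by (intro prod_le_1 conjI pseudohyperbolic_le_1) (use assms in \<open>auto simp: pseudohyperbolic_def\<close>)

lemma cmod_cnj_mult_less_1:
  assumes "cmod w < 1" "cmod z < 1"
  shows "cmod (cnj w * z) \<le> cmod w" "cmod (cnj w * z) \<le> cmod z" "cmod (cnj w * z) < 1"
  using mult_left_le_one_le[of "cmod z" "cmod w"] mult_right_le_one_le[of "cmod w" "cmod z"] assms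
  by (auto simp: norm_mult)

text \<open>The parameter \<open>a\<close> covers two uses: \<open>1 - |z|\<^sup>2\<close> turns
  \<open>1 - \<rho>\<^sup>2\<close> into a Herglotz term, and \<open>1 - |w|\<^sup>2\<close> does
  the same for the squared kernel in the interpolation series.\<close>

lemma poisson_le_herglotz:
  assumes "cmod w < 1" "cmod z < 1" and a: "a \<le> 1 - (cmod (cnj w * z))\<^sup>2"
  shows "(1 - (cmod w)\<^sup>2) * a / (cmod (1 - cnj w * z))\<^sup>2
    \<le> (1 - (cmod w)\<^sup>2) * Re ((1 + cnj w * z) / (1 - cnj w * z))"
proof -
  have "0 \<le> 1 - (cmod w)\<^sup>2" using assms by (simp add: abs_square_le_1)
  then have "(1 - (cmod w)\<^sup>2) * (a / (cmod (1 - cnj w * z))\<^sup>2)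
      \<le> (1 - (cmod w)\<^sup>2) * ((1 - (cmod (cnj w * z))\<^sup>2) / (cmod (1 - cnj w * z))\<^sup>2)"
    using a by (intro mult_left_mono divide_right_mono) auto
  then show ?thesis
    unfolding herglotz_kernel[OF cmod_cnj_mult_less_1(3)[OF assms(1,2)]] by simp
qed

context
  fixes \<Lambda> :: "complex set" and H :: "complex \<Rightarrow> complex"
  assumes \<Lambda>: "\<Lambda> \<subseteq> ball 0 1" and bl: "blaschke \<Lambda>"
  defines "H \<equiv> herglotz_sum (\<lambda>w. 1 - (cmod w)\<^sup>2) \<Lambda>"
begin

lemma in_disc: "w \<in> \<Lambda> \<Longrightarrow> cmod w < 1"
  using \<Lambda> by auto

lemma weight_nonneg: "w \<in> \<Lambda> \<Longrightarrow> 0 \<le> 1 - (cmod w)\<^sup>2"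
  using in_disc by (simp add: abs_square_le_1 less_imp_le)

lemma weight_summable: "(\<lambda>w. 1 - (cmod w)\<^sup>2) summable_on \<Lambda>"
proof (rule summable_on_comparison_test)
  show "(\<lambda>w. 2 * (1 - cmod w)) summable_on \<Lambda>"
    using bl unfolding blaschke_def by (rule summable_on_cmult_right)
  show "1 - (cmod w)\<^sup>2 \<le> 2 * (1 - cmod w)" if "w \<in> \<Lambda>" for w
  proof -
    have "0 \<le> (1 - cmod w)\<^sup>2" by simp
    then show ?thesis by (simp add: power2_eq_square algebra_simps)
  qed
qed (rule weight_nonneg)

lemmas herglotz = \<Lambda> weight_nonneg weight_summable

lemma countable_\<Lambda>: "countable \<Lambda>"
proof -
  have "countable {w \<in> \<Lambda>. 1 - (cmod w)\<^sup>2 \<noteq> 0}" by (rule summable_countable_real[OF weight_summable])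
  moreover have "1 - (cmod w)\<^sup>2 \<noteq> 0" if "w \<in> \<Lambda>" for w
    using in_disc[OF that] norm_ge_zero[of w] by (simp add: power2_eq_1_iff del: norm_ge_zero)
  ultimately show ?thesis by (metis (mono_tags, lifting) Collect_mem_eq Collect_cong)
qed

text \<open>Each factor costs at most its Herglotz term divided by \<delta> in the exponent, and
  partial sums of these terms stay below \<open>Re (H z)\<close>. The bound is therefore uniform in
  \<open>F\<close>.\<close>

lemma finite_blaschke_lower_bound:
  assumes \<delta>: "0 < \<delta>" "\<And>z w. z \<in> \<Lambda> \<Longrightarrow> w \<in> \<Lambda> \<Longrightarrow> z \<noteq> w \<Longrightarrow> \<delta> \<le> pseudohyperbolic z w"
    and F: "finite F" "F \<subseteq> \<Lambda>" and z: "z \<in> \<Lambda>"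
  shows "exp (- (1 / \<delta> * Re (H z))) \<le> cmod (finite_blaschke (F - {z}) z)"
proof -
  let ?p = "\<lambda>w. (1 - (cmod w)\<^sup>2) * Re ((1 + cnj w * z) / (1 - cnj w * z))"
  have step: "exp (- (?p w / \<delta>)) \<le> pseudohyperbolic z w" if w: "w \<in> F - {z}" for w
  proof -
    have w1: "cmod w < 1" and z1: "cmod z < 1" using in_disc w z F by auto
    have "(cmod (cnj w * z))\<^sup>2 \<le> (cmod z)\<^sup>2"
      using cmod_cnj_mult_less_1(2)[OF w1 z1] by (intro power_mono) auto
    then have "1 - (pseudohyperbolic z w)\<^sup>2 \<le> ?p w"
      using poisson_le_herglotz[OF w1 z1, of "1 - (cmod z)\<^sup>2"]
      unfolding one_minus_pseudohyperbolic_sq[OF z1 w1] by (simp add: mult.commute)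
    then have "(1 - (pseudohyperbolic z w)\<^sup>2) / \<delta> \<le> ?p w / \<delta>"
      using \<delta>(1) by (intro divide_right_mono) auto
    then have "exp (- (?p w / \<delta>)) \<le> exp (- ((1 - (pseudohyperbolic z w)\<^sup>2) / \<delta>))" by simp
    also have "\<dots> \<le> pseudohyperbolic z w"
      by (rule exp_neg_le_of_lower_bound) (use \<delta> w z F w1 z1 pseudohyperbolic_le_1 in auto)
    finally show ?thesis .
  qed
  have "(\<Sum>w\<in>F - {z}. ?p w) \<le> Re (H z)" unfolding H_def
    by (rule Re_herglotz_partial_sum_le[OF herglotz]) (use F z in_disc in auto)
  then have "exp (- (1 / \<delta> * Re (H z))) \<le> exp (- (1 / \<delta> * (\<Sum>w\<in>F - {z}. ?p w)))"
    using \<delta>(1) by (simp add: divide_right_mono)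
  also have "\<dots> = (\<Prod>w\<in>F - {z}. exp (- (?p w / \<delta>)))"
    using F by (simp add: exp_sum[symmetric] sum_negf sum_divide_distrib)
  also have "\<dots> \<le> (\<Prod>w\<in>F - {z}. pseudohyperbolic z w)"
    by (rule prod_mono) (use step in auto)
  finally show ?thesis by (simp add: cmod_finite_blaschke)
qed

text \<open>
  The squared reproducing kernels are small enough to sum to at most \<open>Re H\<close>, and
  \<open>x \<le> exp x\<close> lets \<open>exp (- H)\<close> absorb that sum, so the bound \<open>M\<close> does not depend on \<open>F\<close>.
\<close>

lemma finite_interpolation:
  assumes F: "finite F" "F \<subseteq> \<Lambda>" and \<omega>: "\<And>w. w \<in> \<Lambda> \<Longrightarrow> cmod (\<omega> w) \<le> M" and M: "0 \<le> M"
    and C: "\<And>w. w \<in> F \<Longrightarrow> exp (- (C * Re (H w))) \<le> cmod (finite_blaschke (F - {w}) w)"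
  shows "\<exists>b. b holomorphic_on ball 0 1 \<and> (\<forall>z\<in>ball 0 1. cmod (b z) \<le> M) \<and>
    (\<forall>w\<in>F. b w = \<omega> w * exp (- (of_real (C + 1) * H w)))"
proof -
  define B where "B w = finite_blaschke (F - {w})" for w
  define k where "k w z = (of_real (1 - (cmod w)\<^sup>2) / (1 - cnj w * z))\<^sup>2" for w z
  \<comment> \<open>At points of \<open>F\<close>, \<open>t w\<close> equals
    \<open>\<omega> w * exp (- C * H w)\<close> at \<open>w\<close> and 0 elsewhere, because
    \<open>B w\<close> vanishes there and \<open>k w w = 1\<close>. The prefactor
    \<open>exp (- H z)\<close> of \<open>b\<close> turns \<open>C\<close> into
    \<open>C + 1\<close>.\<close>
  define t where "t w z = \<omega> w * (B w z / B w w) * k w z * exp (- (of_real C * H w))" for w z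
  define b where "b z = exp (- H z) * (\<Sum>w\<in>F. t w z)" for z
  have holH: "H holomorphic_on ball 0 1" unfolding H_def by (rule herglotz_sum_holomorphic[OF herglotz])
  have B0: "B w w \<noteq> 0" if "w \<in> F" for w
    using C[OF that] exp_gt_zero[of "- (C * Re (H w))"] by (auto simp: B_def)
  have FD: "F - {w} \<subseteq> ball 0 1" for w using F \<Lambda> by auto
  have "b holomorphic_on ball 0 1"
    unfolding b_def t_def k_def B_def
    by (intro holomorphic_intros holH finite_blaschke_holomorphic FD one_minus_cnj_mult_nonzero')
      (use B0 F in_disc in \<open>auto simp: B_def\<close>)
  moreover have "cmod (b z) \<le> M" if z: "cmod z < 1" for z
  proof -
    have term_le: "cmod (t w z) \<le> M * ((1 - (cmod w)\<^sup>2) * Re ((1 + cnj w * z) / (1 - cnj w * z)))" if w: "w \<in> F" for w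
    proof -
      have w1: "cmod w < 1" using w F in_disc by auto
      \<comment> \<open>The weight \<open>exp (- C * H w)\<close> compensates the possibly small
        denominator \<open>B w w\<close>.\<close>
      have "cmod (B w z / B w w) * cmod (exp (- (of_real C * H w))) \<le> 1"
      proof -
        have "cmod (B w z) * exp (- (C * Re (H w))) \<le> 1 * cmod (B w w)"
          using cmod_finite_blaschke_le_1[OF FD z] C[OF w] unfolding B_def by (intro mult_mono) auto
        then show ?thesis using B0[OF w] by (simp add: norm_divide norm_exp_eq_Re field_simps)
      qed
      moreover have "cmod (k w z) \<le> (1 - (cmod w)\<^sup>2) * Re ((1 + cnj w * z) / (1 - cnj w * z))"
      proof -
        have "(cmod (cnj w * z))\<^sup>2 \<le> (cmod w)\<^sup>2"
          using cmod_cnj_mult_less_1(1)[OF w1 z] by (intro power_mono) auto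
        then have "(1 - (cmod w)\<^sup>2) * (1 - (cmod w)\<^sup>2) / (cmod (1 - cnj w * z))\<^sup>2
            \<le> (1 - (cmod w)\<^sup>2) * Re ((1 + cnj w * z) / (1 - cnj w * z))"
          by (intro poisson_le_herglotz[OF w1 z]) auto
        moreover have "cmod (k w z) = (1 - (cmod w)\<^sup>2) * (1 - (cmod w)\<^sup>2) / (cmod (1 - cnj w * z))\<^sup>2"
          unfolding k_def norm_power norm_divide norm_of_real power_divide power2_abs
          by (simp add: power2_eq_square)
        ultimately show ?thesis by simp
      qed
      moreover have "cmod (\<omega> w) \<le> M" using \<omega> w F by auto
      ultimately have "cmod (\<omega> w) * ((cmod (B w z / B w w) * cmod (exp (- (of_real C * H w)))) * cmod (k w z))
          \<le> M * (1 * ((1 - (cmod w)\<^sup>2) * Re ((1 + cnj w * z) / (1 - cnj w * z))))"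
        using M by (intro mult_mono) auto
      then show ?thesis unfolding t_def by (simp only: norm_mult mult_ac mult_1_right)
    qed
    have "cmod (\<Sum>w\<in>F. t w z) \<le> (\<Sum>w\<in>F. M * ((1 - (cmod w)\<^sup>2) * Re ((1 + cnj w * z) / (1 - cnj w * z))))"
      by (rule order_trans[OF norm_sum sum_mono]) (rule term_le)
    also have "\<dots> \<le> M * Re (H z)"
      unfolding sum_distrib_left[symmetric] H_def
      by (intro mult_left_mono Re_herglotz_partial_sum_le[OF herglotz] F z M)
    also have "\<dots> \<le> M * exp (Re (H z))"
    proof (rule mult_left_mono[OF _ M])
      show "Re (H z) \<le> exp (Re (H z))" using exp_ge_add_one_self[of "Re (H z)"] by linarith
    qed
    finally have "cmod (\<Sum>w\<in>F. t w z) \<le> M * exp (Re (H z))" .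
    then show ?thesis by (simp add: b_def norm_mult norm_divide norm_exp_eq_Re exp_minus field_simps)
  qed
  moreover have "b v = \<omega> v * exp (- (of_real (C + 1) * H v))" if v: "v \<in> F" for v
  proof -
    have "t w v = 0" if "w \<in> F - {v}" for w
    proof -
      have "B w v = 0" unfolding B_def finite_blaschke_def
        by (rule prod_zero) (use F v that in auto)
      then show ?thesis by (simp add: t_def)
    qed
    then have "(\<Sum>w\<in>F. t w v) = t v v"
      using F v by (simp add: sum.remove[OF F(1) v])
    moreover have "k v v = 1"
    proof -
      have "1 - cnj v * v = of_real (1 - (cmod v)\<^sup>2)"
        by (simp only: of_real_diff of_real_1 complex_norm_square mult.commute[of "cnj v"])
      moreover have "1 - cnj v * v \<noteq> 0" using one_minus_cnj_mult_nonzero' v F in_disc by auto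
      ultimately show ?thesis by (simp add: k_def)
    qed
    ultimately show ?thesis
      using B0[OF v] by (simp add: b_def t_def distrib_right exp_add[symmetric] exp_diff exp_minus) (simp add: exp_add field_simps)
  qed
  ultimately show ?thesis by auto
qed

text \<open>The finite solutions share the bound \<open>M\<close>, so Montel's theorem yields a
  locally uniform limit; at each point of \<Lambda> the prescribed value is attained from some index
  on.\<close>

lemma bounded_interpolation:
  assumes \<delta>: "0 < \<delta>" "\<And>z w. z \<in> \<Lambda> \<Longrightarrow> w \<in> \<Lambda> \<Longrightarrow> z \<noteq> w \<Longrightarrow> \<delta> \<le> pseudohyperbolic z w"
    and \<omega>: "\<And>w. w \<in> \<Lambda> \<Longrightarrow> cmod (\<omega> w) \<le> M" and M: "0 \<le> M"
  shows "\<exists>b. b holomorphic_on ball 0 1 \<and> (\<forall>z. cmod z < 1 \<longrightarrow> cmod (b z) \<le> M) \<and>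
    (\<forall>w\<in>\<Lambda>. b w = \<omega> w * exp (- (of_real (1 / \<delta> + 1) * H w)))"
proof -
  \<comment> \<open>Intersecting with \<Lambda> matters when \<Lambda> is empty, where
    \<open>from_nat_into\<close> returns an arbitrary point.\<close>
  define F where "F n = from_nat_into \<Lambda> ` {..n::nat} \<inter> \<Lambda>" for n
  define P where "P n b \<longleftrightarrow> b holomorphic_on ball 0 1 \<and> (\<forall>z\<in>ball 0 1. cmod (b z) \<le> M) \<and>
    (\<forall>w\<in>F n. b w = \<omega> w * exp (- (of_real (1 / \<delta> + 1) * H w)))" for n b
  have "\<exists>b. P n b" for n
    unfolding P_def
    by (rule finite_interpolation[OF _ _ \<omega> M finite_blaschke_lower_bound[OF \<delta>]]) (auto simp: F_def)
  then obtain b where b: "\<And>n. P n (b n)" by metis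
  obtain g r where g: "g holomorphic_on ball 0 1" and r: "strict_mono (r :: nat \<Rightarrow> nat)"
    and lim: "\<And>x. x \<in> ball 0 1 \<Longrightarrow> ((\<lambda>n. b (r n) x) \<longlongrightarrow> g x) sequentially"
  proof (rule Montel[of "ball 0 1" "{h. h holomorphic_on ball 0 1 \<and> (\<forall>z\<in>ball 0 1. cmod (h z) \<le> M)}" b])
    show "\<exists>B. \<forall>h\<in>{h. h holomorphic_on ball 0 1 \<and> (\<forall>z\<in>ball 0 1. cmod (h z) \<le> M)}. \<forall>z\<in>K. cmod (h z) \<le> B"
      if "K \<subseteq> ball 0 1" for K
      using that by (intro exI[of _ M]) blast
  qed (use b in \<open>auto simp: P_def\<close>)
  show ?thesis
  proof (intro exI[of _ g] conjI allI impI ballI g)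
    fix z :: complex assume z: "cmod z < 1"
    show "cmod (g z) \<le> M"
      by (rule LIMSEQ_le_const2[OF tendsto_norm[OF lim]]) (use z b in \<open>auto simp: P_def\<close>)
  next
    fix w assume w: "w \<in> \<Lambda>"
    then obtain n where n: "from_nat_into \<Lambda> n = w" using from_nat_into_surj[OF countable_\<Lambda>] by blast
    have "\<forall>\<^sub>F k in sequentially. b (r k) w = \<omega> w * exp (- (of_real (1 / \<delta> + 1) * H w))"
      unfolding eventually_sequentially
    proof (intro exI[of _ n] allI impI)
      fix k assume "n \<le> k"
      then have "n \<le> r k" using seq_suble[OF r, of k] by simp
      then have "w \<in> F (r k)" using n w by (auto simp: F_def)
      then show "b (r k) w = \<omega> w * exp (- (of_real (1 / \<delta> + 1) * H w))" using b[of "r k"] by (simp add: P_def)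
    qed
    then have "(\<lambda>k. b (r k) w) \<longlonglongrightarrow> \<omega> w * exp (- (of_real (1 / \<delta> + 1) * H w))"
      by (rule tendsto_eventually)
    then show "g w = \<omega> w * exp (- (of_real (1 / \<delta> + 1) * H w))"
      using lim[of w] w \<Lambda> LIMSEQ_unique by blast
  qed
qed

lemma quasi_bounded_interpolation:
  assumes sep: "separated \<Lambda>" and \<omega>: "bounded (\<omega> ` \<Lambda>)"
  obtains h G W B where "h holomorphic_on ball 0 1" "G holomorphic_on ball 0 1"
    "\<And>z. cmod z < 1 \<Longrightarrow> 0 \<le> Re (G z) \<and> cmod (h z) \<le> exp (Re (G z))"
    "\<And>w. w \<in> \<Lambda> \<Longrightarrow> h w = \<omega> w" "boundary_function h B"
    "\<And>\<theta>. 0 \<le> W \<theta>" "(W has_integral 2 * pi * Re (G 0)) {0..2*pi}"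
    "AE \<theta> in lebesgue_on {0..2*pi}. ((\<lambda>r. Re (G (of_real r * cis \<theta>))) \<longlongrightarrow> W \<theta>) (at_left 1)"
proof -
  obtain \<delta> where \<delta>: "0 < \<delta>" "\<And>z w. z \<in> \<Lambda> \<Longrightarrow> w \<in> \<Lambda> \<Longrightarrow> z \<noteq> w \<Longrightarrow> \<delta> \<le> pseudohyperbolic z w"
    using separated_lower_bound[OF sep] by blast
  obtain M0 where M0: "\<And>w. w \<in> \<Lambda> \<Longrightarrow> cmod (\<omega> w) \<le> M0"
    using \<omega> by (auto simp: bounded_iff)
  \<comment> \<open>A bound of at least 1 makes \<open>K = ln M\<close> nonnegative, so the constant
    added to \<open>c * H\<close> keeps \<open>Re G\<close> nonnegative.\<close>
  define M where "M = max 1 M0"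
  have M: "1 \<le> M" "\<And>w. w \<in> \<Lambda> \<Longrightarrow> cmod (\<omega> w) \<le> M" using M0 by (auto simp: M_def intro: max.coboundedI2)
  define c where "c = 1 / \<delta> + 1"
  have c: "0 < c" using \<delta>(1) by (simp add: c_def add_pos_pos)
  have M_nonneg: "0 \<le> M" using M(1) by simp
  have "\<exists>b. b holomorphic_on ball 0 1 \<and> (\<forall>z. cmod z < 1 \<longrightarrow> cmod (b z) \<le> M) \<and>
    (\<forall>w\<in>\<Lambda>. b w = \<omega> w * exp (- (of_real c * H w)))"
    unfolding c_def by (rule bounded_interpolation[OF \<delta> M(2) M_nonneg])
  then obtain b where b: "b holomorphic_on ball 0 1" "\<And>z. cmod z < 1 \<Longrightarrow> cmod (b z) \<le> M"
    "\<And>w. w \<in> \<Lambda> \<Longrightarrow> b w = \<omega> w * exp (- (of_real c * H w))"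
    by blast
  define K where "K = ln M"
  have K: "0 \<le> K" "exp K = M" using M(1) by (auto simp: K_def)
  define G where "G z = of_real c * H z + of_real K" for z
  obtain W where W: "\<And>\<theta>. 0 \<le> W \<theta>" "(W has_integral 2 * pi * Re (G 0)) {0..2*pi}"
    "AE \<theta> in lebesgue_on {0..2*pi}. ((\<lambda>r. Re (G (of_real r * cis \<theta>))) \<longlongrightarrow> W \<theta>) (at_left 1)"
    using herglotz_sum_quasi_bounded[OF herglotz c K(1)] unfolding G_def H_def by blast
  have holH: "H holomorphic_on ball 0 1" unfolding H_def by (rule herglotz_sum_holomorphic[OF herglotz])
  have ReH: "0 \<le> Re (H z)" if "cmod z < 1" for z
    unfolding H_def by (rule Re_herglotz_sum_nonneg[OF herglotz that])
  define E where "E z = exp (- (of_real c * H z))" for z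
  define h where "h z = b z / E z" for z
  have holE: "E holomorphic_on ball 0 1" unfolding E_def by (intro holomorphic_intros holH)
  have lim_b: "AE \<theta> in lebesgue_on {0..2*pi}. \<exists>l. nontangential_limit b (cis \<theta>) l"
    by (rule Fatou_bounded_holomorphic_AE[OF b(1,2)])
  have E1: "cmod (E z) \<le> 1" if "cmod z < 1" for z
    using ReH[of z] that c by (simp add: E_def norm_exp_eq_Re)
  have lim_E: "AE \<theta> in lebesgue_on {0..2*pi}. \<exists>l. nontangential_limit E (cis \<theta>) l"
    by (rule Fatou_bounded_holomorphic_AE[OF holE E1])
  \<comment> \<open>Both \<open>b\<close> and \<open>E\<close> are bounded, so Fatou's theorem
    applies to each. Their quotient has a limit wherever that of \<open>E\<close> is nonzero, and
    \<open>|E| = exp (K - Re G)\<close> tends to the positive number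
    \<open>exp (K - W \<theta>)\<close>.\<close>
  have lim_h: "AE \<theta> in lebesgue_on {0..2*pi}. \<exists>l. nontangential_limit h (cis \<theta>) l"
    using lim_b lim_E W(3)
  proof eventually_elim
    case (elim \<theta>)
    then obtain l m where lm: "nontangential_limit b (cis \<theta>) l" "nontangential_limit E (cis \<theta>) m" by blast
    have "((\<lambda>r. exp (K - Re (G (of_real r * cis \<theta>)))) \<longlongrightarrow> exp (K - W \<theta>)) (at_left 1)"
      using elim(3) by (intro tendsto_intros)
    moreover have "cmod (E (of_real r * cis \<theta>)) = exp (K - Re (G (of_real r * cis \<theta>)))" for r
      by (simp add: E_def G_def norm_exp_eq_Re)
    ultimately have "cmod m = exp (K - W \<theta>)"
      using tendsto_norm[OF nontangential_limit_imp_radial[OF lm(2)]] tendsto_unique[of "at_left (1::real)"] by auto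
    then have "m \<noteq> 0" by auto
    then have "nontangential_limit h (cis \<theta>) (l / m)"
      using lm unfolding nontangential_limit_def h_def by (auto intro!: tendsto_divide)
    then show ?case by blast
  qed
  have bf: "boundary_function h (\<lambda>\<zeta>. SOME l. nontangential_limit h \<zeta> l)"
    unfolding boundary_function_def using lim_h by eventually_elim (rule someI_ex)
  have "h holomorphic_on ball 0 1" unfolding h_def
    by (intro holomorphic_intros b holE) (simp add: E_def)
  moreover have "G holomorphic_on ball 0 1" unfolding G_def by (intro holomorphic_intros holH)
  moreover have "0 \<le> Re (G z) \<and> cmod (h z) \<le> exp (Re (G z))" if z: "cmod z < 1" for z
  proof
    show "0 \<le> Re (G z)" using c K ReH[OF z] by (simp add: G_def)
    have "cmod (h z) = cmod (b z) * exp (c * Re (H z))"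
      unfolding h_def E_def norm_divide norm_exp_eq_Re by (simp add: exp_minus divide_inverse)
    also have "\<dots> \<le> M * exp (c * Re (H z))" using b(2)[OF z] by (intro mult_right_mono) auto
    also have "\<dots> = exp (Re (G z))" by (simp add: G_def exp_add K)
    finally show "cmod (h z) \<le> exp (Re (G z))" .
  qed
  moreover have "h w = \<omega> w" if "w \<in> \<Lambda>" for w
    using b(3)[OF that] by (simp add: h_def E_def)
  ultimately show ?thesis using that bf W by blast
qed

end

section \<open>Free interpolation\<close>

theorem corollary1p8:
  fixes \<Lambda> :: "complex set"
  assumes "\<Lambda> \<subseteq> ball 0 1" and "separated \<Lambda>" and "blaschke \<Lambda>"
  shows "free_interpolating smirnov_class \<Lambda> \<and> free_interpolating nevanlinna_class \<Lambda>"
proof -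
  \<comment> \<open>Ideality of the trace reduces to multipliers: if \<open>h\<close> takes the
    values \<omega> on \<Lambda> and \<open>h * f\<close> stays in \<open>X\<close>, then
    \<open>h * f\<close> has trace \<open>\<omega> * a\<close>.\<close>
  have free: "free_interpolating X \<Lambda>"
    if X: "\<And>\<omega> f. bounded (\<omega> ` \<Lambda>) \<Longrightarrow> f \<in> X \<Longrightarrow> \<exists>h. (\<forall>w\<in>\<Lambda>. h w = \<omega> w) \<and> (\<lambda>z. h z * f z) \<in> X"
    for X :: "(complex \<Rightarrow> complex) set"
    unfolding free_interpolating_def
  proof (intro ballI allI impI)
    fix a and \<omega> :: "complex \<Rightarrow> complex" assume a: "a \<in> trace_space X \<Lambda>" and \<omega>: "bounded (\<omega> ` \<Lambda>)"
    from a obtain f where f: "f \<in> X" "a = restrict f \<Lambda>" by (auto simp: trace_space_def)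
    from X[OF \<omega> f(1)] obtain h where h: "\<And>w. w \<in> \<Lambda> \<Longrightarrow> h w = \<omega> w" "(\<lambda>z. h z * f z) \<in> X" by blast
    have "restrict (\<lambda>z. \<omega> z * a z) \<Lambda> = restrict (\<lambda>z. h z * f z) \<Lambda>"
      using h(1) f(2) by (auto simp: restrict_def)
    then show "restrict (\<lambda>z. \<omega> z * a z) \<Lambda> \<in> trace_space X \<Lambda>"
      using h(2) by (auto simp: trace_space_def)
  qed
  show ?thesis
  proof (intro conjI free)
    fix \<omega> f :: "complex \<Rightarrow> complex" assume \<omega>: "bounded (\<omega> ` \<Lambda>)" and f: "f \<in> smirnov_class"
    show "\<exists>h. (\<forall>w\<in>\<Lambda>. h w = \<omega> w) \<and> (\<lambda>z. h z * f z) \<in> smirnov_class"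
      by (rule quasi_bounded_interpolation[OF assms(1,3,2) \<omega>]) (use smirnov_class_mult[OF f] in blast)
  next
    fix \<omega> f :: "complex \<Rightarrow> complex" assume \<omega>: "bounded (\<omega> ` \<Lambda>)" and f: "f \<in> nevanlinna_class"
    show "\<exists>h. (\<forall>w\<in>\<Lambda>. h w = \<omega> w) \<and> (\<lambda>z. h z * f z) \<in> nevanlinna_class"
      by (rule quasi_bounded_interpolation[OF assms(1,3,2) \<omega>]) (use nevanlinna_class_mult[OF f] in blast)
  qed
qed

end
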